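(* Let $p$ be an odd prime and let $H=\langle a,b,c,d\rangle$ be the $p$-group of nilpotency class $2$ defined by the additional relations $$a^p=[a,c],\qquad b^p=[a,bcd],\qquad c^p=[b,cd],\qquad d^p=[b,d].$$ Let $\langle z\rangle$ be a cyclic group of order $p^2$, let $M\leq H'$ be a subgroup of order $p$ with $M\nsubseteq H^p$, and let $G_1=H\rtimes_M\langle z\rangle$, where $z$ acts trivially on $H$. Then $G_1$ is a non-special $p$-group and the following hold: (1) If $M=\langle [a,b]\rangle$, then $G_1$ is a Miller group. (2) If $M=\langle [a,d]\rangle$, then $G_1$ is not a Miller group.
   Context: Notation: $[x,y]=xyx^{-1}y^{-1}$; $H'$ is the commutator subgroup of $H$; $H^p=\langle h^p : h\in H\rangle$; $\Phi(H)$ is the Frattini subgroup and $Z(H)$ the center. The group $H$ is the group presented by generators $a,b,c,d$ subject to the relations $[[x,y],w]=1$ for all $x,y,w$ (nilpotency class at most $2$) together with the displayed relations; it is a finite $p$-group of order $p^{10}$. A Miller group is a non-abelian group whose automorphism group is abelian. A $p$-group $K$ is special if $Z(K)=K'=\Phi(K)$. Amalgamated semi-direct product: a group $G$ is the amalgamated semi-direct product of subgroups $H$ by $K$ over $M$, written $G=H\rtimes_M K$, if $H\trianglelefteq G$, $G=HK$ and $H\cap K=M$. (Externally: $M\leq H$ is identified with a subgroup of $K$ by an injective homomorphism, compatibly with a given action of $K$ on $H$.) Here $K=\langle z\rangle$ has order $p^2$, $z$ commutes with every element of $H$ inside $G_1$, and $H\cap\langle z\rangle=M=\langle z^p\rangle$.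 *)

theory Defs
  imports "HOL-Algebra.Algebra" "HOL-Computational_Algebra.Primes"
begin

text \<open>A letter \<open>(x, True)\<close> stands for the generator \<open>x\<close>, and \<open>(x, False)\<close> for its formal
  inverse.  The generators are all elements of the type \<open>'x\<close>.\<close>

type_synonym 'x word = "('x \<times> bool) list"

definition word_gen :: "'x \<Rightarrow> 'x word" where
  "word_gen x = [(x, True)]"

definition word_inv :: "'x word \<Rightarrow> 'x word" where
  "word_inv u = rev (map (\<lambda>(x, e). (x, \<not> e)) u)"

definition word_pow :: "'x word \<Rightarrow> nat \<Rightarrow> 'x word" where
  "word_pow u n = concat (replicate n u)"

definition word_comm :: "'x word \<Rightarrow> 'x word \<Rightarrow> 'x word" where
  "word_comm u v = u @ v @ word_inv u @ word_inv v"

text \<open>The least congruence on words that contains the pairs in \<open>R\<close> and makes the two letters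
  belonging to a generator mutually inverse.  A pair \<open>(u, v) \<in> R\<close> is the relation \<open>u = v\<close>.\<close>

inductive word_eq :: "('x word \<times> 'x word) set \<Rightarrow> 'x word \<Rightarrow> 'x word \<Rightarrow> bool"
  for R :: "('x word \<times> 'x word) set" where
  rel: "(u, v) \<in> R \<Longrightarrow> word_eq R u v"
| cancel: "word_eq R [(x, e), (x, \<not> e)] []"
| refl: "word_eq R u u"
| sym: "word_eq R u v \<Longrightarrow> word_eq R v u"
| trans: "word_eq R u v \<Longrightarrow> word_eq R v w \<Longrightarrow> word_eq R u w"
| append: "word_eq R u u' \<Longrightarrow> word_eq R v v' \<Longrightarrow> word_eq R (u @ v) (u' @ v')"

definition word_class :: "('x word \<times> 'x word) set \<Rightarrow> 'x word \<Rightarrow> 'x word set" where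
  "word_class R u = {v. word_eq R u v}"

definition presented_group :: "('x word \<times> 'x word) set \<Rightarrow> 'x word set monoid" where
  "presented_group R =
     \<lparr>carrier = range (word_class R),
      monoid.mult = (\<lambda>A B. \<Union>u\<in>A. \<Union>v\<in>B. word_class R (u @ v)),
      one = word_class R []\<rparr>"

definition has_presentation ::
  "('g, 'm) monoid_scheme \<Rightarrow> ('x \<Rightarrow> 'g) \<Rightarrow> ('x word \<times> 'x word) set \<Rightarrow> bool" where
  "has_presentation G g R \<longleftrightarrow>
     group G \<and>
     (\<exists>\<phi> \<in> iso (presented_group R) G. \<forall>x. \<phi> (word_class R (word_gen x)) = g x)"

lemma word_class_eq_iff: "word_class R u = word_class R v \<longleftrightarrow> word_eq R u v"
proof
  assume "word_class R u = word_class R v"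
  moreover have "v \<in> word_class R v"
    by (simp add: word_class_def word_eq.refl)
  ultimately show "word_eq R u v"
    by (simp add: word_class_def set_eq_iff)
next
  assume uv: "word_eq R u v"
  have "word_eq R u w \<longleftrightarrow> word_eq R v w" for w
    using word_eq.trans[OF uv] word_eq.trans[OF word_eq.sym[OF uv]] by metis
  then show "word_class R u = word_class R v"
    by (simp add: word_class_def)
qed

lemma presented_group_mult:
  "word_class R u \<otimes>\<^bsub>presented_group R\<^esub> word_class R v = word_class R (u @ v)"
proof -
  have same: "word_class R (u' @ v') = word_class R (u @ v)"
    if u': "u' \<in> word_class R u" and v': "v' \<in> word_class R v" for u' v'
  proof -
    from u' v' have "word_eq R u u'" "word_eq R v v'"
      by (simp_all add: word_class_def)
    then have "word_eq R (u @ v) (u' @ v')"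
      by (rule word_eq.append)
    then show ?thesis
      by (simp only: word_class_eq_iff word_eq.sym)
  qed
  have "u \<in> word_class R u" "v \<in> word_class R v"
    by (simp_all add: word_class_def word_eq.refl)
  then have "(\<Union>u'\<in>word_class R u. \<Union>v'\<in>word_class R v. word_class R (u' @ v')) = word_class R (u @ v)"
    using same by blast
  then show ?thesis
    by (simp add: presented_group_def)
qed

lemma word_eq_inv_left: "word_eq R (word_inv u @ u) []"
proof (induction u)
  case Nil
  show ?case by (simp add: word_inv_def word_eq.refl)
next
  case (Cons l u)
  obtain x e where l: "l = (x, e)" by (cases l)
  have "word_eq R [(x, \<not> e), (x, e)] []"
    using word_eq.cancel[of R x "\<not> e"] by simp
  then have "word_eq R (word_inv u @ [(x, \<not> e), (x, e)] @ u) (word_inv u @ [] @ u)"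
    by (intro word_eq.append word_eq.refl)
  from word_eq.trans[OF this] Cons.IH
  have "word_eq R (word_inv u @ [(x, \<not> e), (x, e)] @ u) []"
    by simp
  then show ?case
    by (simp add: word_inv_def l)
qed

lemma group_presented_group: "group (presented_group R)"
proof (rule groupI)
  have carr: "carrier (presented_group R) = range (word_class R)"
    and one: "\<one>\<^bsub>presented_group R\<^esub> = word_class R []"
    by (simp_all add: presented_group_def)
  show "\<one>\<^bsub>presented_group R\<^esub> \<in> carrier (presented_group R)"
    by (simp add: carr one)
  fix A assume A: "A \<in> carrier (presented_group R)"
  then obtain u where u: "A = word_class R u" by (auto simp: carr)
  show "\<one>\<^bsub>presented_group R\<^esub> \<otimes>\<^bsub>presented_group R\<^esub> A = A"
    by (simp add: u one presented_group_mult)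
  have "word_class R (word_inv u) \<otimes>\<^bsub>presented_group R\<^esub> A = \<one>\<^bsub>presented_group R\<^esub>"
    by (simp add: u one presented_group_mult word_class_eq_iff word_eq_inv_left)
  then show "\<exists>B\<in>carrier (presented_group R). B \<otimes>\<^bsub>presented_group R\<^esub> A = \<one>\<^bsub>presented_group R\<^esub>"
    by (auto simp: carr)
  fix B assume "B \<in> carrier (presented_group R)"
  then obtain v where v: "B = word_class R v" by (auto simp: carr)
  show "A \<otimes>\<^bsub>presented_group R\<^esub> B \<in> carrier (presented_group R)"
    by (simp add: u v carr presented_group_mult)
  fix C assume "C \<in> carrier (presented_group R)"
  then obtain w where w: "C = word_class R w" by (auto simp: carr)
  show "A \<otimes>\<^bsub>presented_group R\<^esub> B \<otimes>\<^bsub>presented_group R\<^esub> C =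
        A \<otimes>\<^bsub>presented_group R\<^esub> (B \<otimes>\<^bsub>presented_group R\<^esub> C)"
    by (simp add: u v w presented_group_mult)
qed

datatype gen4 = GA | GB | GC | GD

definition H_relations :: "nat \<Rightarrow> (gen4 word \<times> gen4 word) set" where
  "H_relations p =
     (let a = word_gen GA; b = word_gen GB; c = word_gen GC; d = word_gen GD in
      {(word_comm (word_comm x y) w, []) | x y w. True} \<union>
      {(word_pow a p, word_comm a c),
       (word_pow b p, word_comm a (b @ c @ d)),
       (word_pow c p, word_comm b (c @ d)),
       (word_pow d p, word_comm b d)})"

definition commutator :: "('g, 'm) monoid_scheme \<Rightarrow> 'g \<Rightarrow> 'g \<Rightarrow> 'g" where
  "commutator G x y = x \<otimes>\<^bsub>G\<^esub> y \<otimes>\<^bsub>G\<^esub> inv\<^bsub>G\<^esub> x \<otimes>\<^bsub>G\<^esub> inv\<^bsub>G\<^esub> y"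

definition power_subgroup :: "('g, 'm) monoid_scheme \<Rightarrow> 'g set \<Rightarrow> nat \<Rightarrow> 'g set" where
  "power_subgroup G H n = generate G {h [^]\<^bsub>G\<^esub> n | h. h \<in> H}"

definition center :: "('g, 'm) monoid_scheme \<Rightarrow> 'g set" where
  "center G = {x \<in> carrier G. \<forall>y \<in> carrier G. x \<otimes>\<^bsub>G\<^esub> y = y \<otimes>\<^bsub>G\<^esub> x}"

definition maximal_subgroup :: "'g set \<Rightarrow> ('g, 'm) monoid_scheme \<Rightarrow> bool" where
  "maximal_subgroup N G \<longleftrightarrow>
     subgroup N G \<and> N \<noteq> carrier G \<and>
     (\<forall>L. subgroup L G \<and> N \<subseteq> L \<longrightarrow> L = N \<or> L = carrier G)"

text \<open>Intersecting with the carrier makes the Frattini subgroup of a group without maximal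
  subgroups the whole group.\<close>

definition frattini :: "('g, 'm) monoid_scheme \<Rightarrow> 'g set" where
  "frattini G = carrier G \<inter> \<Inter> {N. maximal_subgroup N G}"

definition finite_p_group :: "nat \<Rightarrow> ('g, 'm) monoid_scheme \<Rightarrow> bool" where
  "finite_p_group p G \<longleftrightarrow> group G \<and> (\<exists>n. order G = p ^ n)"

definition special_p_group :: "nat \<Rightarrow> ('g, 'm) monoid_scheme \<Rightarrow> bool" where
  "special_p_group p G \<longleftrightarrow>
     finite_p_group p G \<and>
     center G = derived G (carrier G) \<and> derived G (carrier G) = frattini G"

definition miller_group :: "('g, 'm) monoid_scheme \<Rightarrow> bool" where
  "miller_group G \<longleftrightarrow> group G \<and> \<not> comm_group G \<and> comm_group (AutoGroup G)"

definition amalgamated_semidirect ::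
  "('g, 'm) monoid_scheme \<Rightarrow> 'g set \<Rightarrow> 'g set \<Rightarrow> 'g set \<Rightarrow> bool" where
  "amalgamated_semidirect G H K M \<longleftrightarrow>
     H \<lhd> G \<and> subgroup K G \<and> carrier G = H <#>\<^bsub>G\<^esub> K \<and> H \<inter> K = M"

end

theory Submission
  imports Defs
begin

text \<open>Let \<open>V = H/H'\<close>, so that \<open>H' = \<Lambda>\<^sup>2 V\<close> and, \<open>p\<close> being odd, the \<open>p\<close>-th power map is a linear map
  \<open>\<pi> : V \<rightarrow> \<Lambda>\<^sup>2 V\<close>.  The central element \<open>z\<close> of \<open>G\<^sub>1\<close> is not in \<open>G\<^sub>1' = H'\<close>, hence \<open>G\<^sub>1\<close> is not
  special.  An automorphism of \<open>G\<^sub>1\<close> preserves the center, so modulo \<open>G\<^sub>1'\<close> it acts as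
  \<open>v \<mapsto> \<alpha> v + \<lambda>(v) z\<close>, \<open>z \<mapsto> s z\<close>, and the power relations say
  \<open>\<Lambda>\<^sup>2\<alpha> (\<pi> v) = \<pi> (\<alpha> v) + \<lambda>(v) m\<close> and \<open>\<Lambda>\<^sup>2\<alpha> (m) = s m\<close>, where \<open>m = z^p\<close>.
  If \<open>m\<close> is a multiple of \<open>a \<and> b\<close>, these equations force \<open>\<alpha> = 1\<close>, \<open>\<lambda> = 0\<close>, \<open>s = 1\<close>; then every
  automorphism multiplies each element by an element of \<open>G\<^sub>1'\<close> and fixes \<open>G\<^sub>1'\<close>, and any two such
  automorphisms commute.  If \<open>y\<close> is a power of \<open>z\<close> with \<open>y^p = [a, d]\<close>, then
  \<open>a \<mapsto> a y\<close>, \<open>b \<mapsto> b y\<close>, \<open>c \<mapsto> c d\<close> defines an automorphism which does not commute with the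
  automorphism \<open>d \<mapsto> d [a, b]\<close>.\<close>

section \<open>Word invariants\<close>

text \<open>The \<open>(i, j)\<close> coordinate of the wedge product of the vectors
  \<open>f\<close> and \<open>g\<close>.\<close>

definition minor :: "'x \<Rightarrow> 'x \<Rightarrow> ('x \<Rightarrow> int) \<Rightarrow> ('x \<Rightarrow> int) \<Rightarrow> int" where
  "minor i j f g = f i * g j - f j * g i"

fun letter_vec :: "'x \<times> bool \<Rightarrow> 'x \<Rightarrow> int" where
  "letter_vec (x, e) y = (if y = x then if e then 1 else - 1 else 0)"

text \<open>The image of a word in the free abelian group on the generators, given by its exponent
  sums.\<close>

definition word_vec :: "'x word \<Rightarrow> 'x \<Rightarrow> int" where
  "word_vec w y = (\<Sum>l\<leftarrow>w. letter_vec l y)"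

lemma word_vec_Nil [simp]: "word_vec [] = (\<lambda>_. 0)"
  by (simp add: word_vec_def fun_eq_iff)

lemma word_vec_append [simp]: "word_vec (u @ v) = (\<lambda>y. word_vec u y + word_vec v y)"
  by (simp add: word_vec_def fun_eq_iff)

lemma word_inv_append [simp]: "word_inv (u @ v) = word_inv v @ word_inv u"
  by (simp add: word_inv_def)

lemma word_inv_Nil [simp]: "word_inv [] = []"
  by (simp add: word_inv_def)

lemma word_inv_Cons: "word_inv (l # u) = word_inv u @ [(fst l, \<not> snd l)]"
  by (simp add: word_inv_def split: prod.splits)

lemma word_vec_inv [simp]: "word_vec (word_inv u) = (\<lambda>y. - word_vec u y)"
  by (induction u) (auto simp: fun_eq_iff word_inv_Cons, auto simp: word_vec_def)

lemma word_pow_0 [simp]: "word_pow u 0 = []"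
  and word_pow_Suc [simp]: "word_pow u (Suc n) = u @ word_pow u n"
  by (simp_all add: word_pow_def)

lemma word_vec_pow [simp]: "word_vec (word_pow u n) = (\<lambda>y. int n * word_vec u y)"
  by (induction n) (auto simp: fun_eq_iff algebra_simps)

lemma word_vec_comm [simp]: "word_vec (word_comm u v) = (\<lambda>_. 0)"
  by (simp add: word_comm_def)

text \<open>Encodes a relation \<open>x^p = [u, v]\<close> as the pair \<open>(u, v)\<close>, so
  that the four power relations can be treated uniformly in \<open>x\<close>.\<close>

fun power_relation :: "gen4 \<Rightarrow> gen4 word \<times> gen4 word" where
  "power_relation GA = (word_gen GA, word_gen GC)"
| "power_relation GB = (word_gen GA, word_gen GB @ word_gen GC @ word_gen GD)"
| "power_relation GC = (word_gen GB, word_gen GC @ word_gen GD)"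
| "power_relation GD = (word_gen GB, word_gen GD)"

lemma H_relations_cases:
  assumes "(u, v) \<in> H_relations p"
  obtains (comm) x y w where "u = word_comm (word_comm x y) w" "v = []"
  | (pow) x where "u = word_pow (word_gen x) p"
      "v = word_comm (fst (power_relation x)) (snd (power_relation x))"
proof -
  have "(\<exists>x y w. u = word_comm (word_comm x y) w \<and> v = []) \<or>
    (\<exists>x. u = word_pow (word_gen x) p \<and>
      v = word_comm (fst (power_relation x)) (snd (power_relation x)))"
    using assms unfolding H_relations_def Let_def
    by (elim UnE insertE; simp) (metis fst_conv snd_conv power_relation.simps)+
  then show thesis using that by blast
qed

lemma comm_mem_H_relations: "(word_comm (word_comm x y) w, []) \<in> H_relations p"
  by (auto simp: H_relations_def Let_def)

lemma pow_mem_H_relations: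
  "(word_pow (word_gen x) p, word_comm (fst (power_relation x)) (snd (power_relation x)))
     \<in> H_relations p"
  by (cases x) (auto simp: H_relations_def Let_def)

text \<open>The \<open>(i, j)\<close> coordinate of \<open>\<pi>\<close> at the generator
  \<open>x\<close>.\<close>

definition frob :: "gen4 \<Rightarrow> gen4 \<Rightarrow> gen4 \<Rightarrow> int" where
  "frob i j x =
     minor i j (word_vec (fst (power_relation x))) (word_vec (snd (power_relation x)))"

text \<open>With \<open>V = \<int>\<^sup>4\<close>, this is the \<open>(i, j)\<close> coordinate of the value of a word in the group
  \<open>V \<times> \<Lambda>\<^sup>2 V\<close> with product \<open>(x, s) (y, t) = (x + y, s + t + p (x \<and> y))\<close>, where the generator \<open>x\<close>
  has second component \<open>2 (u \<and> v)\<close> if \<open>x^p = [u, v]\<close> is a defining relation.  Taken modulo \<open>p\<close> in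
  \<open>V\<close> and modulo \<open>p^2\<close> in \<open>\<Lambda>\<^sup>2 V\<close>, it satisfies the defining relations of \<open>H\<close>.\<close>

fun twist :: "nat \<Rightarrow> gen4 \<Rightarrow> gen4 \<Rightarrow> gen4 word \<Rightarrow> int" where
  "twist p i j [] = 0"
| "twist p i j ((x, e) # w) =
     (if e then 1 else - 1) * (2 * frob i j x) + twist p i j w
       + int p * minor i j (letter_vec (x, e)) (word_vec w)"

text \<open>The correction term is bilinear in the exponent vectors, so the recursion over letters
  extends to products of words.\<close>

lemma twist_append:
  "twist p i j (u @ v) =
     twist p i j u + twist p i j v + int p * minor i j (word_vec u) (word_vec v)"
proof (induction u)
  case (Cons l u)
  have "word_vec (l # u) = (\<lambda>y. letter_vec l y + word_vec u y)" for u
    by (simp add: word_vec_def fun_eq_iff)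
  then show ?case
    using Cons by (cases l) (simp add: minor_def algebra_simps)
qed (simp add: minor_def)

lemma word_vec_single: "word_vec [l] = letter_vec l"
  by (simp add: word_vec_def fun_eq_iff)

lemma twist_single: "twist p i j [(x, e)] = (if e then 1 else - 1) * (2 * frob i j x)"
  by (simp add: minor_def)

lemma twist_inv: "twist p i j (word_inv u) = - twist p i j u"
proof (induction u)
  case (Cons l u)
  obtain x e where l: "l = (x, e)" by (cases l)
  have neg: "word_vec [(x, \<not> e)] = (\<lambda>y. - letter_vec (x, e) y)"
    by (auto simp: fun_eq_iff word_vec_single)
  have tneg: "twist p i j [(x, \<not> e)] = - ((if e then 1 else - 1) * (2 * frob i j x))"
    by (cases e) (simp_all add: minor_def)
  have "twist p i j (word_inv (l # u)) =
      - twist p i j u - (if e then 1 else - 1) * (2 * frob i j x)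
        + int p * minor i j (\<lambda>y. - word_vec u y) (\<lambda>y. - letter_vec (x, e) y)"
    unfolding l word_inv_Cons twist_append fst_conv snd_conv tneg Cons.IH neg word_vec_inv
    by (rule arg_cong2[of _ _ _ _ "(+)"]) (rule diff_conv_add_uminus[symmetric], rule HOL.refl)
  also have "\<dots> = - twist p i j (l # u)"
    unfolding l twist.simps minor_def by (cases e)
      (simp_all only: if_True if_False, simp_all add: algebra_simps del: letter_vec.simps)
  finally show ?case .
qed simp

lemma twist_pow: "twist p i j (word_pow u n) = int n * twist p i j u"
  by (induction n) (simp_all add: twist_append minor_def algebra_simps)

text \<open>Everything cancels except the wedge, which the two orders of the product contribute with
  opposite signs. The resulting 2 matches the factor 2 given to generators in \<open>twist\<close>,
  so the power relations hold exactly there.\<close>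

lemma twist_comm:
  "twist p i j (word_comm u v) = 2 * int p * minor i j (word_vec u) (word_vec v)"
  unfolding word_comm_def
  by (simp add: twist_append twist_inv minor_def algebra_simps)

text \<open>The defining relations hold by \<open>twist_comm\<close> and \<open>twist_pow\<close>.
  The two moduli fit together because a change of exponent vectors by multiples of \<open>p\<close>
  changes \<open>p\<close> times a minor by a multiple of \<open>p^2\<close>.\<close>

lemma word_eq_invariants:
  assumes "word_eq (H_relations p) u v"
  shows "(\<forall>x. int p dvd word_vec u x - word_vec v x)
       \<and> (int p)\<^sup>2 dvd twist p i j u - twist p i j v"
  using assms
proof (induction rule: word_eq.induct)
  case (rel u v)
  then show ?case
  proof (cases rule: H_relations_cases)
    case (comm x y w)
    then show ?thesis by (simp add: twist_comm minor_def)
  next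
    case (pow x)
    then show ?thesis
      by (simp add: twist_comm twist_pow frob_def[symmetric] word_gen_def twist_single
          del: twist.simps)
  qed
next
  case (cancel x e)
  have "word_vec [(x, e), (x, \<not> e)] = (\<lambda>_. 0)"
    by (auto simp: word_vec_def fun_eq_iff)
  moreover have "twist p i j [(x, e), (x, \<not> e)] = 0"
    by (simp add: minor_def word_vec_single)
  ultimately show ?case by (simp del: twist.simps(2))
next
  case (sym u v)
  then show ?case by (simp add: dvd_diff_commute)
next
  case (trans u v w)
  have "int p dvd (word_vec u x - word_vec v x) + (word_vec v x - word_vec w x)" for x
    using trans by (intro dvd_add) auto
  moreover have "(int p)\<^sup>2 dvd
      (twist p i j u - twist p i j v) + (twist p i j v - twist p i j w)"
    using trans by (intro dvd_add) auto
  ultimately show ?case by simp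
next
  case (append u u' v v')
  let ?m = "minor i j (word_vec u) (word_vec v)" and ?m' = "minor i j (word_vec u') (word_vec v')"
  have vec: "int p dvd word_vec (u @ v) x - word_vec (u' @ v') x" for x
    using dvd_add[of "int p" "word_vec u x - word_vec u' x" "word_vec v x - word_vec v' x"] append
    by (simp add: algebra_simps)
  have prod: "int p dvd word_vec u x * word_vec v y - word_vec u' x * word_vec v' y" for x y
  proof -
    have "word_vec u x * word_vec v y - word_vec u' x * word_vec v' y =
      (word_vec u x - word_vec u' x) * word_vec v y
        + word_vec u' x * (word_vec v y - word_vec v' y)"
      by (simp add: algebra_simps)
    then show ?thesis using append by (simp add: dvd_add)
  qed
  have "?m - ?m' = (word_vec u i * word_vec v j - word_vec u' i * word_vec v' j)
      - (word_vec u j * word_vec v i - word_vec u' j * word_vec v' i)"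
    by (simp add: minor_def)
  then have "int p dvd ?m - ?m'" using prod by (simp add: dvd_diff)
  then have "(int p)\<^sup>2 dvd int p * (?m - ?m')"
    by (simp add: power2_eq_square)
  moreover have "twist p i j (u @ v) - twist p i j (u' @ v') =
    (twist p i j u - twist p i j u') + (twist p i j v - twist p i j v') + int p * (?m - ?m')"
    by (simp add: twist_append algebra_simps)
  ultimately show ?case using vec append by (simp only: dvd_add simp_thms)
qed auto

text \<open>The wedge corrections carry a factor \<open>p\<close>; modulo \<open>p\<close> only the
  linear map \<open>2 \<pi>\<close> of the exponent vector survives.\<close>

lemma twist_mod:
  "int p dvd twist p i j w - 2 * (word_vec w GA * frob i j GA + word_vec w GB * frob i j GB
     + word_vec w GC * frob i j GC + word_vec w GD * frob i j GD)"
proof (induction w)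
  case (Cons l w)
  obtain x e where l: "l = (x, e)" by (cases l)
  have v: "word_vec ((x, e) # w) y = letter_vec (x, e) y + word_vec w y" for y
    by (simp add: word_vec_def)
  have "(if e then 1 else - 1) * (2 * frob i j x)
      = 2 * (letter_vec (x, e) GA * frob i j GA + letter_vec (x, e) GB * frob i j GB
     + letter_vec (x, e) GC * frob i j GC + letter_vec (x, e) GD * frob i j GD)"
    by (cases x) simp_all
  then have "twist p i j (l # w) - 2 * (word_vec (l # w) GA * frob i j GA
      + word_vec (l # w) GB * frob i j GB
     + word_vec (l # w) GC * frob i j GC + word_vec (l # w) GD * frob i j GD)
    = twist p i j w - 2 * (word_vec w GA * frob i j GA + word_vec w GB * frob i j GB
     + word_vec w GC * frob i j GC + word_vec w GD * frob i j GD)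
      + int p * minor i j (letter_vec (x, e)) (word_vec w)"
    unfolding l v twist.simps by (simp add: algebra_simps del: letter_vec.simps)
  then show ?case using Cons.IH by (simp only: dvd_add dvd_triv_left)
qed simp

text \<open>The matrix of \<open>\<pi>\<close>: the generators go to \<open>a \<and> c\<close>,
  \<open>a \<and> b + a \<and> c + a \<and> d\<close>, \<open>b \<and> c + b \<and> d\<close> and
  \<open>b \<and> d\<close>.\<close>

lemma frob_simps [simp]:
  "frob GA GB x = (if x = GB then 1 else 0)"
  "frob GA GC x = (if x = GA \<or> x = GB then 1 else 0)"
  "frob GA GD x = (if x = GB then 1 else 0)"
  "frob GB GC x = (if x = GC then 1 else 0)"
  "frob GB GD x = (if x = GC \<or> x = GD then 1 else 0)"
  by (cases x; simp add: frob_def minor_def word_gen_def word_vec_def; fail)+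

section \<open>The linear equations for an automorphism\<close>

text \<open>The tuples \<open>(a1, \<dots>, a4)\<close>, \<open>\<dots>\<close>, \<open>(d1, \<dots>, d4)\<close> are the images of \<open>a, b, c, d\<close> under \<open>\<alpha>\<close>, the
  numbers \<open>la, \<dots>, ld\<close> are the values of \<open>\<lambda>\<close>, and \<open>m = k (a \<and> b)\<close>.  The hypotheses are
  coordinates of \<open>\<Lambda>\<^sup>2\<alpha> (a \<and> b) = s (a \<and> b)\<close> and of the relations for \<open>a\<^sup>p\<close>, \<open>b\<^sup>p\<close>, \<open>c\<^sup>p\<close>, \<open>d\<^sup>p\<close>.\<close>

lemma rigidity_mod_prime:
  fixes P a1 a2 a3 a4 b1 b2 b3 b4 c1 c2 c3 c4 d1 d2 d3 d4 la lb lc ld k s :: int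
  assumes P: "Factorial_Ring.prime P" "\<not> P dvd 2" and k: "\<not> P dvd k" and s: "\<not> P dvd s"
    and "P dvd (a1 * b2 - a2 * b1) - s"
    and "P dvd (a1 * b3 - a3 * b1)"
    and "P dvd (a1 * b4 - a4 * b1)"
    and "P dvd (a2 * b3 - a3 * b2)"
    and "P dvd (a2 * b4 - a4 * b2)"
    and "P dvd a2 + la * k - (a1 * c2 - a2 * c1)"
    and "P dvd a1 + a2 - (a1 * c3 - a3 * c1)"
    and "P dvd a2 - (a1 * c4 - a4 * c1)"
    and "P dvd a3 - (a2 * c3 - a3 * c2)"
    and "P dvd a3 + a4 - (a2 * c4 - a4 * c2)"
    and "P dvd b2 + lb * k - (a1 * (b2 + (c2 + d2)) - a2 * (b1 + (c1 + d1)))"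
    and "P dvd b1 + b2 - (a1 * (b3 + (c3 + d3)) - a3 * (b1 + (c1 + d1)))"
    and "P dvd b2 - (a1 * (b4 + (c4 + d4)) - a4 * (b1 + (c1 + d1)))"
    and "P dvd c2 + lc * k - (b1 * (c2 + d2) - b2 * (c1 + d1))"
    and "P dvd c1 + c2 - (b1 * (c3 + d3) - b3 * (c1 + d1))"
    and "P dvd c2 - (b1 * (c4 + d4) - b4 * (c1 + d1))"
    and "P dvd c3 - (b2 * (c3 + d3) - b3 * (c2 + d2))"
    and "P dvd c3 + c4 - (b2 * (c4 + d4) - b4 * (c2 + d2))"
    and "P dvd d2 + ld * k - (b1 * d2 - b2 * d1)"
    and "P dvd d1 + d2 - (b1 * d3 - b3 * d1)"
    and "P dvd d2 - (b1 * d4 - b4 * d1)"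
    and "P dvd d3 + d4 - (b2 * d4 - b4 * d2)"
  shows "P dvd a1 - 1 \<and> P dvd a2 \<and> P dvd a3 \<and> P dvd a4 \<and>
    P dvd b1 \<and> P dvd b2 - 1 \<and> P dvd b3 \<and> P dvd b4 \<and>
    P dvd c1 \<and> P dvd c2 \<and> P dvd c3 - 1 \<and> P dvd c4 \<and>
    P dvd d1 \<and> P dvd d2 \<and> P dvd d3 \<and> P dvd d4 - 1 \<and>
    P dvd la \<and> P dvd lb \<and> P dvd lc \<and> P dvd ld \<and>
    P dvd s - 1"
proof -
  note prime_dvd = Factorial_Ring.prime_dvd_mult_iff[OF P(1), THEN iffD1]
  \<comment> \<open>The first letter names the equation (\<open>z\<close> for the one with
    \<open>s\<close>, otherwise the generator whose power relation it is), the other two the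
    coordinate. All these quantities vanish modulo \<open>P\<close>, and each deduction below writes
    its target as a polynomial combination of known multiples of \<open>P\<close>.\<close>
  define zab where "zab = (a1 * b2 - a2 * b1) - s"
  define zac where "zac = (a1 * b3 - a3 * b1)"
  define zad where "zad = (a1 * b4 - a4 * b1)"
  define zbc where "zbc = (a2 * b3 - a3 * b2)"
  define zbd where "zbd = (a2 * b4 - a4 * b2)"
  define aab where "aab = a2 + la * k - (a1 * c2 - a2 * c1)"
  define aac where "aac = a1 + a2 - (a1 * c3 - a3 * c1)"
  define aad where "aad = a2 - (a1 * c4 - a4 * c1)"
  define abc where "abc = a3 - (a2 * c3 - a3 * c2)"
  define abd where "abd = a3 + a4 - (a2 * c4 - a4 * c2)"
  define bab where "bab = b2 + lb * k - (a1 * (b2 + (c2 + d2)) - a2 * (b1 + (c1 + d1)))"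
  define bac where "bac = b1 + b2 - (a1 * (b3 + (c3 + d3)) - a3 * (b1 + (c1 + d1)))"
  define bad where "bad = b2 - (a1 * (b4 + (c4 + d4)) - a4 * (b1 + (c1 + d1)))"
  define cab where "cab = c2 + lc * k - (b1 * (c2 + d2) - b2 * (c1 + d1))"
  define cac where "cac = c1 + c2 - (b1 * (c3 + d3) - b3 * (c1 + d1))"
  define cad where "cad = c2 - (b1 * (c4 + d4) - b4 * (c1 + d1))"
  define cbc where "cbc = c3 - (b2 * (c3 + d3) - b3 * (c2 + d2))"
  define cbd where "cbd = c3 + c4 - (b2 * (c4 + d4) - b4 * (c2 + d2))"
  define dab where "dab = d2 + ld * k - (b1 * d2 - b2 * d1)"
  define dac where "dac = d1 + d2 - (b1 * d3 - b3 * d1)"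
  define dad where "dad = d2 - (b1 * d4 - b4 * d1)"
  define dbd where "dbd = d3 + d4 - (b2 * d4 - b4 * d2)"
  \<comment> \<open>Deviations from the identity matrix and from \<open>s = 1\<close>.\<close>
  define a1' b2' c3' d4' s' where "a1' = a1 - 1" and "b2' = b2 - 1"
    and "c3' = c3 - 1" and "d4' = d4 - 1" and "s' = s - 1"
    note defs = zab_def zac_def zad_def zbc_def zbd_def aab_def aac_def aad_def abc_def abd_def
    bab_def bac_def bad_def cab_def cac_def cad_def cbc_def cbd_def dab_def dac_def dad_def
    dbd_def a1'_def b2'_def c3'_def d4'_def s'_def
  note rules = dvd_add dvd_diff dvd_mult dvd_mult2
    have facts: "P dvd zab" "P dvd zac" "P dvd zad" "P dvd zbc" "P dvd zbd" "P dvd aab" "P dvd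
    aac" "P dvd aad" "P dvd abc" "P dvd abd" "P dvd bab" "P dvd bac" "P dvd bad" "P dvd cab" "P
    dvd cac" "P dvd cad" "P dvd cbc" "P dvd cbd" "P dvd dab" "P dvd dac" "P dvd dad" "P dvd
    dbd"
    using assms unfolding defs by simp_all
  \<comment> \<open>A determinant with a repeated row vanishes. Since the \<open>a \<and> b\<close>
    minor is the unit \<open>s\<close>, this gives \<open>a3 = a4 = b3 = b4 = 0\<close> modulo
    \<open>P\<close>: the plane spanned by \<open>a\<close> and \<open>b\<close> is
    preserved.\<close>
  have "P dvd a2 * zac - a3 * zab - a1 * zbc"
    by (fact | rule rules)+
  also have "a2 * zac - a3 * zab - a1 * zbc = a3 * s"
    unfolding defs by (simp add: algebra_simps)
  finally have a3s: "P dvd a3 * s" .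
  have a3: "P dvd a3" using a3s s prime_dvd by blast
  have "P dvd a2 * zad - a4 * zab - a1 * zbd"
    by (fact | rule rules)+
  also have "a2 * zad - a4 * zab - a1 * zbd = a4 * s"
    unfolding defs by (simp add: algebra_simps)
  finally have a4s: "P dvd a4 * s" .
  have a4: "P dvd a4" using a4s s prime_dvd by blast
  have "P dvd b2 * zac - b3 * zab - b1 * zbc"
    by (fact | rule rules)+
  also have "b2 * zac - b3 * zab - b1 * zbc = b3 * s"
    unfolding defs by (simp add: algebra_simps)
  finally have b3s: "P dvd b3 * s" .
  have b3: "P dvd b3" using b3s s prime_dvd by blast
  have "P dvd b2 * zad - b4 * zab - b1 * zbd"
    by (fact | rule rules)+
  also have "b2 * zad - b4 * zab - b1 * zbd = b4 * s"
    unfolding defs by (simp add: algebra_simps)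
  finally have b4s: "P dvd b4 * s" .
  have b4: "P dvd b4" using b4s s prime_dvd by blast
  \<comment> \<open>The relation for \<open>a^p\<close> gives \<open>a2 c3 = a2 c4 = 0\<close> and
    \<open>a2 = a1 c4\<close>, hence \<open>a2\<close> squares to zero.\<close>
  have "P dvd a3 + c2 * a3 - abc"
    by (fact | rule rules)+
  also have "a3 + c2 * a3 - abc = a2 * c3"
    unfolding defs by (simp add: algebra_simps)
  finally have a2c3: "P dvd a2 * c3" .
  have "P dvd a3 + a4 + c2 * a4 - abd"
    by (fact | rule rules)+
  also have "a3 + a4 + c2 * a4 - abd = a2 * c4"
    unfolding defs by (simp add: algebra_simps)
  finally have a2c4: "P dvd a2 * c4" .
  have "P dvd a2 * aad + a1 * (a2 * c4) - a2 * c1 * a4"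
    by (fact | rule rules)+
  also have "a2 * aad + a1 * (a2 * c4) - a2 * c1 * a4 = a2 * a2"
    unfolding defs by (simp add: algebra_simps)
  finally have a2a2: "P dvd a2 * a2" .
  have a2: "P dvd a2" using a2a2 prime_dvd by blast
  \<comment> \<open>Now \<open>a1 b2 = s\<close>, so \<open>a1\<close> and \<open>b2\<close> are
    units and may be cancelled.\<close>
  have a1b2: "\<not> P dvd a1 * b2"
  proof
    assume "P dvd a1 * b2"
    have "P dvd a1 * b2 - b1 * a2 - zab" by (fact | rule rules)+
    then show False using s unfolding defs by (simp add: algebra_simps)
  qed
  then have a1n: "\<not> P dvd a1" and b2n: "\<not> P dvd b2" by auto
  have "P dvd a2 + c1 * a4 - aad"
    by (fact | rule rules)+
  also have "a2 + c1 * a4 - aad = a1 * c4"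
    unfolding defs by (simp add: algebra_simps)
  finally have a1c4: "P dvd a1 * c4" .
  have c4: "P dvd c4" using a1c4 a1n prime_dvd by blast
  have "P dvd a2 + c1 * a3 - aac"
    by (fact | rule rules)+
  also have "a2 + c1 * a3 - aac = a1 * c3'"
    unfolding defs by (simp add: algebra_simps)
  finally have a1c3': "P dvd a1 * c3'" .
  have c3': "P dvd c3'" using a1c3' a1n prime_dvd by blast
  \<comment> \<open>With \<open>c3 = 1\<close> and \<open>c4 = 0\<close>, the relation for
    \<open>c^p\<close> gives \<open>b2 (1 + d3) = 1 = b2 d4\<close>, and the one for
    \<open>d^p\<close> gives \<open>d3 + d4 = b2 d4 = 1\<close>. Adding the two equations for
    \<open>d3\<close> and \<open>d4\<close> leaves \<open>2 d3 = 0\<close>, where oddness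
    enters.\<close>
  have "P dvd cbd - cbc - b2 * c3' - c4 + b2 * c4 - (c2 + d2) * b4 + (c2 + d2) * b3"
    by (fact | rule rules)+
  also have "cbd - cbc - b2 * c3' - c4 + b2 * c4 - (c2 + d2) * b4 + (c2 + d2) * b3 = b2 * (1 + d3 - d4)"
    unfolding defs by (simp add: algebra_simps)
  finally have b2x: "P dvd b2 * (1 + d3 - d4)" .
  have x: "P dvd 1 + d3 - d4" using b2x b2n prime_dvd by blast
  have "P dvd dbd + c3' + c4 - b2 * c4 + (c2 + d2) * b4 - cbd - d2 * b4"
    by (fact | rule rules)+
  also have "dbd + c3' + c4 - b2 * c4 + (c2 + d2) * b4 - cbd - d2 * b4 = d3 + d4 - 1"
    unfolding defs by (simp add: algebra_simps)
  finally have y: "P dvd d3 + d4 - 1" .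
  have "P dvd (1 + d3 - d4) + (d3 + d4 - 1)" using x y by (rule dvd_add)
  then have "P dvd 2 * d3" by (simp add: algebra_simps)
  then have d3: "P dvd d3" using P(2) prime_dvd by blast
  have "P dvd d3 - (1 + d3 - d4)" using d3 x by (rule dvd_diff)
  then have d4': "P dvd d4'" unfolding defs by (simp add: algebra_simps)
  \<comment> \<open>From \<open>b2 d4 = 1\<close> and \<open>d4 = 1\<close> follows
    \<open>b2 = 1\<close>; the remaining entries are then determined one after another.\<close>
  have "P dvd c3' + c4 - b2 * c4 + (c2 + d2) * b4 - cbd - b2 * d4'"
    by (fact | rule rules)+
  also have "c3' + c4 - b2 * c4 + (c2 + d2) * b4 - cbd - b2 * d4' = b2'"
    unfolding defs by (simp add: algebra_simps)
  finally have b2': "P dvd b2'" .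
  have "P dvd b2' - a1 * d4' - a1 * b4 - a1 * c4 + (b1 + c1 + d1) * a4 - bad"
    by (fact | rule rules)+
  also have "b2' - a1 * d4' - a1 * b4 - a1 * c4 + (b1 + c1 + d1) * a4 - bad = a1'"
    unfolding defs by (simp add: algebra_simps)
  finally have a1': "P dvd a1'" .
  have "P dvd bac - b2' + a1 * b3 + a1 * c3' + a1' + a1 * d3 - (b1 + c1 + d1) * a3"
    by (fact | rule rules)+
  also have "bac - b2' + a1 * b3 + a1 * c3' + a1' + a1 * d3 - (b1 + c1 + d1) * a3 = b1"
    unfolding defs by (simp add: algebra_simps)
  finally have b1: "P dvd b1" .
  have "P dvd cad + (c4 + d4) * b1 - (c1 + d1) * b4"
    by (fact | rule rules)+
  also have "cad + (c4 + d4) * b1 - (c1 + d1) * b4 = c2"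
    unfolding defs by (simp add: algebra_simps)
  finally have c2: "P dvd c2" .
  have "P dvd cac - c2 + (c3 + d3) * b1 - (c1 + d1) * b3"
    by (fact | rule rules)+
  also have "cac - c2 + (c3 + d3) * b1 - (c1 + d1) * b3 = c1"
    unfolding defs by (simp add: algebra_simps)
  finally have c1: "P dvd c1" .
  have "P dvd dad + d4 * b1 - d1 * b4"
    by (fact | rule rules)+
  also have "dad + d4 * b1 - d1 * b4 = d2"
    unfolding defs by (simp add: algebra_simps)
  finally have d2: "P dvd d2" .
  have "P dvd dac - d2 + d3 * b1 - d1 * b3"
    by (fact | rule rules)+
  also have "dac - d2 + d3 * b1 - d1 * b3 = d1"
    unfolding defs by (simp add: algebra_simps)
  finally have d1: "P dvd d1" .
  have "P dvd a1 * b2' + a1' - b1 * a2 - zab"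
    by (fact | rule rules)+
  also have "a1 * b2' + a1' - b1 * a2 - zab = s'"
    unfolding defs by (simp add: algebra_simps)
  finally have s': "P dvd s'" .
  \<comment> \<open>With all matrix entries known, the \<open>a \<and> b\<close> coordinates reduce
    to \<open>k\<close> times the values of \<open>\<lambda>\<close>, and \<open>k\<close> is a
    unit.\<close>
  have "P dvd aab - a2 + a1 * c2 - c1 * a2"
    by (fact | rule rules)+
  also have "aab - a2 + a1 * c2 - c1 * a2 = la * k"
    unfolding defs by (simp add: algebra_simps)
  finally have lak: "P dvd la * k" .
  have la: "P dvd la" using lak k prime_dvd by blast
  have "P dvd bab + b2 * a1' + a1 * c2 + a1 * d2 - (b1 + c1 + d1) * a2"
    by (fact | rule rules)+
  also have "bab + b2 * a1' + a1 * c2 + a1 * d2 - (b1 + c1 + d1) * a2 = lb * k"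
    unfolding defs by (simp add: algebra_simps)
  finally have lbk: "P dvd lb * k" .
  have lb: "P dvd lb" using lbk k prime_dvd by blast
  have "P dvd cab - c2 + (c2 + d2) * b1 - b2 * c1 - b2 * d1"
    by (fact | rule rules)+
  also have "cab - c2 + (c2 + d2) * b1 - b2 * c1 - b2 * d1 = lc * k"
    unfolding defs by (simp add: algebra_simps)
  finally have lck: "P dvd lc * k" .
  have lc: "P dvd lc" using lck k prime_dvd by blast
  have "P dvd dab - d2 + d2 * b1 - b2 * d1"
    by (fact | rule rules)+
  also have "dab - d2 + d2 * b1 - b2 * d1 = ld * k"
    unfolding defs by (simp add: algebra_simps)
  finally have ldk: "P dvd ld * k" .
  have ld: "P dvd ld" using ldk k prime_dvd by blast
  show ?thesis using a1' a2 a3 a4 b1 b2' b3 b4 c1 c2 c3' c4 d1 d2 d3 d4' la lb lc ld s'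
    unfolding a1'_def b2'_def c3'_def d4'_def s'_def by blast
qed

section \<open>Evaluation of words in a group\<close>

definition word_val :: "('g, 'm) monoid_scheme \<Rightarrow> ('x \<Rightarrow> 'g) \<Rightarrow> 'x word \<Rightarrow> 'g" where
  "word_val G g w =
     foldr (\<lambda>(x, e) r. (if e then g x else inv\<^bsub>G\<^esub> g x) \<otimes>\<^bsub>G\<^esub> r) w \<one>\<^bsub>G\<^esub>"

lemma word_val_Nil [simp]: "word_val G g [] = \<one>\<^bsub>G\<^esub>"
  and word_val_Cons:
    "word_val G g ((x, e) # w) =
      (if e then g x else inv\<^bsub>G\<^esub> g x) \<otimes>\<^bsub>G\<^esub> word_val G g w"
  by (simp_all add: word_val_def)

section \<open>Commutators in an arbitrary group\<close>

context group
begin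

lemma commutator_closed [simp, intro]:
  "x \<in> carrier G \<Longrightarrow> y \<in> carrier G \<Longrightarrow> commutator G x y \<in> carrier G"
  by (simp add: commutator_def)

lemma inv_cancel_left [simp]:
  assumes "x \<in> carrier G" "y \<in> carrier G"
  shows "inv x \<otimes> (x \<otimes> y) = y" "x \<otimes> (inv x \<otimes> y) = y"
  using assms by (simp_all add: m_assoc[symmetric])

lemma commutator_swap:
  "x \<in> carrier G \<Longrightarrow> y \<in> carrier G \<Longrightarrow> x \<otimes> y = commutator G x y \<otimes> (y \<otimes> x)"
  by (simp add: commutator_def m_assoc)

lemma commutator_eq_one_iff:
  assumes "x \<in> carrier G" "y \<in> carrier G"
  shows "commutator G x y = \<one> \<longleftrightarrow> x \<otimes> y = y \<otimes> x"
  using assms by (metis commutator_swap commutator_closed l_one m_closed r_cancel_one')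

lemma inv_commutator:
  "x \<in> carrier G \<Longrightarrow> y \<in> carrier G \<Longrightarrow> inv commutator G x y = commutator G y x"
  by (simp add: commutator_def inv_mult_group m_assoc)

text \<open>The central \<open>u\<close> moves past \<open>y\<close> and cancels its inverse; the
  second identity is the first one inverted.\<close>

lemma commutator_mult_central:
  assumes [simp]: "x \<in> carrier G" "y \<in> carrier G" "u \<in> carrier G"
    and u: "\<And>w. w \<in> carrier G \<Longrightarrow> u \<otimes> w = w \<otimes> u"
  shows "commutator G (x \<otimes> u) y = commutator G x y"
    and "commutator G x (y \<otimes> u) = commutator G x y"
proof -
  have left: "commutator G (x \<otimes> u) y = commutator G x y"
    if [simp]: "x \<in> carrier G" "y \<in> carrier G" for x y
  proof -
    have "commutator G (x \<otimes> u) y = x \<otimes> (u \<otimes> (y \<otimes> (inv u \<otimes> (inv x \<otimes> inv y))))"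
      by (simp add: commutator_def inv_mult_group m_assoc)
    also have "u \<otimes> (y \<otimes> (inv u \<otimes> (inv x \<otimes> inv y))) = y \<otimes> (inv x \<otimes> inv y)"
      using u[of "y \<otimes> (inv u \<otimes> (inv x \<otimes> inv y))"] u[of "inv x \<otimes> inv y", symmetric]
      by (simp add: m_assoc)
    finally show ?thesis by (simp add: commutator_def m_assoc)
  qed
  show "commutator G (x \<otimes> u) y = commutator G x y"
    by (rule left) simp_all
  have "inv commutator G (y \<otimes> u) x = inv commutator G y x"
    by (simp add: left)
  then show "commutator G x (y \<otimes> u) = commutator G x y"
    by (simp add: inv_commutator)
qed

lemma commutator_mem_derived:
  "x \<in> H \<Longrightarrow> y \<in> H \<Longrightarrow> commutator G x y \<in> derived G H"
  unfolding derived_def commutator_def by (rule generate.incl) blast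

lemma derived_subset_subgroup:
  assumes "subgroup L G" "\<And>x y. x \<in> H \<Longrightarrow> y \<in> H \<Longrightarrow> commutator G x y \<in> L"
  shows "derived G H \<subseteq> L"
  unfolding derived_def using assms(2)
  by (intro generate_subgroup_incl[OF _ assms(1)]) (auto simp: commutator_def)

section \<open>Word evaluation as a homomorphism\<close>

context
  fixes g :: "'x \<Rightarrow> 'a"
  assumes g: "\<And>x. g x \<in> carrier G"
begin

lemma word_val_closed [simp, intro]: "word_val G g w \<in> carrier G"
  by (induction w) (auto simp: word_val_Cons g)

lemma word_val_append: "word_val G g (u @ v) = word_val G g u \<otimes> word_val G g v"
  by (induction u) (auto simp: word_val_Cons g m_assoc)

lemma word_val_single: "word_val G g [(x, e)] = (if e then g x else inv g x)"
  using g by (simp add: word_val_Cons)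

lemma word_val_gen: "word_val G g (word_gen x) = g x"
  using g by (simp add: word_val_Cons word_gen_def)

lemma word_val_inv: "word_val G g (word_inv u) = inv word_val G g u"
  by (induction u)
    (auto simp: word_inv_Cons word_val_append word_val_single word_val_Cons g inv_mult_group)

lemma word_val_pow: "word_val G g (word_pow u n) = word_val G g u [^] n"
proof (induction n)
  case (Suc n)
  then show ?case
    by (metis nat_pow_Suc2 word_val_append word_pow_Suc word_val_closed)
qed simp

lemma word_val_comm:
  "word_val G g (word_comm u v) = commutator G (word_val G g u) (word_val G g v)"
  by (simp add: word_comm_def commutator_def word_val_append word_val_inv m_assoc)

lemma word_val_cong:
  assumes "word_eq R u v" "\<And>u v. (u, v) \<in> R \<Longrightarrow> word_val G g u = word_val G g v"
  shows "word_val G g u = word_val G g v"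
  using assms
proof (induction rule: word_eq.induct)
  case (cancel x e)
  then show ?case by (cases e) (simp_all add: word_val_Cons g)
qed (auto simp: word_val_append)

lemma word_val_mem_subgroup:
  assumes "subgroup L G" "\<And>x. g x \<in> L"
  shows "word_val G g w \<in> L"
  using assms
  by (induction w)
    (auto simp: word_val_Cons subgroup.one_closed subgroup.m_closed subgroup.m_inv_closed)

lemma word_val_consistent:
  assumes "subgroup L G" "\<And>x. g x \<in> L"
  shows "word_val (G\<lparr>carrier := L\<rparr>) g w = word_val G g w"
  using assms by (induction w) (auto simp: word_val_Cons m_inv_consistent)

end

lemma word_val_hom:
  assumes h: "h \<in> hom G K" and K: "group K" and g: "\<And>x. g x \<in> carrier G"
  shows "h (word_val G g w) = word_val K (\<lambda>x. h (g x)) w"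
proof -
  interpret h: group_hom G K h
    using h K by (simp add: group_hom_def group_hom_axioms_def)
  show ?thesis
    using g by (induction w) (auto simp: word_val_Cons)
qed

text \<open>Shows that the generator classes generate the presented group, so that a homomorphism
  out of it is determined by their images.\<close>

lemma word_class_eq_word_val:
  "word_class R w = word_val (presented_group R) (\<lambda>x. word_class R (word_gen x)) w"
proof (induction w)
  case Nil
  then show ?case by (simp add: presented_group_def)
next
  case (Cons l w)
  obtain x e where l: "l = (x, e)" by (cases l)
  have carr: "word_class R u \<in> carrier (presented_group R)" for u
    by (simp add: presented_group_def)
  have "word_class R [(x, False)] \<otimes>\<^bsub>presented_group R\<^esub> word_class R [(x, True)]
      = \<one>\<^bsub>presented_group R\<^esub>"
    using word_eq.cancel[of R x False]
    by (simp add: presented_group_mult word_class_eq_iff) (simp add: presented_group_def word_class_eq_iff)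
  then have "inv\<^bsub>presented_group R\<^esub> word_class R [(x, True)] = word_class R [(x, False)]"
    using group.inv_equality[OF group_presented_group] carr by metis
  moreover have "word_class R (l # w)
      = word_class R [l] \<otimes>\<^bsub>presented_group R\<^esub> word_class R w"
    by (simp add: presented_group_mult)
  ultimately show ?case
    using Cons by (simp add: l word_val_Cons word_gen_def)
qed

text \<open>Replaces the abstract isomorphism by its usable content: \<open>H\<close> consists of
  word values, and equality of values is derivability from the relations.\<close>

lemma has_presentation_word_val:
  assumes pres: "has_presentation (G\<lparr>carrier := H\<rparr>) g R" and H: "subgroup H G"
  shows "\<And>x. g x \<in> H" and "H = range (word_val G g)"
    and "word_val G g u = word_val G g v \<longleftrightarrow> word_eq R u v"
proof -
  let ?P = "presented_group R" and ?K = "G\<lparr>carrier := H\<rparr>"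
  obtain f where f: "f \<in> iso ?P ?K" and fg: "\<And>x. f (word_class R (word_gen x)) = g x"
    using pres unfolding has_presentation_def by blast
  have K: "group ?K" using H by (rule subgroup_imp_group)
  have bij: "bij_betw f (carrier ?P) H" and hom: "f \<in> hom ?P ?K"
    using f by (auto simp: iso_def)
  have carr: "carrier ?P = range (word_class R)" by (simp add: presented_group_def)
  show gH: "g x \<in> H" for x
    using bij fg[of x] carr by (metis bij_betwE rangeI)
  have val: "f (word_class R w) = word_val G g w" for w
  proof -
    have "f (word_class R w) = word_val ?K (\<lambda>x. f (word_class R (word_gen x))) w"
      unfolding word_class_eq_word_val[of R w]
      by (rule group.word_val_hom[OF group_presented_group hom K]) (simp add: carr)
    also have "\<dots> = word_val G g w"
      unfolding fg using H gH
      by (intro word_val_consistent) (auto dest: subgroup.mem_carrier)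
    finally show ?thesis .
  qed
  show "H = range (word_val G g)"
    using bij val carr by (auto simp: bij_betw_def image_image)
  show "word_val G g u = word_val G g v \<longleftrightarrow> word_eq R u v"
    using bij carr unfolding val[symmetric] word_class_eq_iff[symmetric]
    by (metis bij_betw_imp_inj_on inj_on_eq_iff rangeI)
qed

end

section \<open>Groups of nilpotency class two\<close>

locale class2_group = group G for G (structure) +
  assumes commutator_central:
    "\<lbrakk>x \<in> carrier G; y \<in> carrier G; w \<in> carrier G\<rbrakk>
      \<Longrightarrow> commutator G x y \<otimes> w = w \<otimes> commutator G x y"
begin

lemma commutator_central_left:
  assumes "x \<in> carrier G" "y \<in> carrier G" "u \<in> carrier G" "v \<in> carrier G"
  shows "u \<otimes> (commutator G x y \<otimes> v) = commutator G x y \<otimes> (u \<otimes> v)"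
  using assms commutator_central[of x y u] by (simp add: m_assoc[symmetric])

lemma commutator_mult_left:
  assumes [simp]: "x \<in> carrier G" "y \<in> carrier G" "w \<in> carrier G"
  shows "commutator G (x \<otimes> y) w = commutator G x w \<otimes> commutator G y w"
proof -
  have "commutator G (x \<otimes> y) w = x \<otimes> (commutator G y w \<otimes> (w \<otimes> inv x \<otimes> inv w))"
    by (simp add: commutator_def inv_mult_group m_assoc)
  also have "\<dots> = commutator G y w \<otimes> (x \<otimes> (w \<otimes> inv x \<otimes> inv w))"
    by (rule commutator_central_left) simp_all
  also have "\<dots> = commutator G y w \<otimes> commutator G x w"
    by (simp add: commutator_def[of G x w] m_assoc)
  finally show ?thesis
    using commutator_central[of y w "commutator G x w"] by simp
qed

lemma commutator_mult_right:
  assumes "x \<in> carrier G" "y \<in> carrier G" "w \<in> carrier G"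
  shows "commutator G x (y \<otimes> w) = commutator G x y \<otimes> commutator G x w"
proof -
  have "commutator G x (y \<otimes> w) = inv (commutator G y x \<otimes> commutator G w x)"
    using assms by (simp add: inv_commutator commutator_mult_left[symmetric])
  then show ?thesis
    using assms commutator_central[of x w "commutator G x y"]
    by (simp add: inv_mult_group inv_commutator)
qed

lemma commutator_one_left [simp]: "x \<in> carrier G \<Longrightarrow> commutator G \<one> x = \<one>"
  by (simp add: commutator_def)

lemma commutator_pow_left:
  assumes "x \<in> carrier G" "y \<in> carrier G"
  shows "commutator G (x [^] (n::nat)) y = commutator G x y [^] n"
  using assms by (induction n) (simp_all add: commutator_mult_left)

lemma commutator_inv_left:
  assumes "x \<in> carrier G" "y \<in> carrier G"
  shows "commutator G (inv x) y = inv commutator G x y"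
proof -
  have "commutator G (inv x) y \<otimes> commutator G x y = \<one>"
    using assms by (simp add: commutator_mult_left[symmetric])
  then show ?thesis using assms by (simp add: inv_equality)
qed

text \<open>By bilinearity of commutators; it reduces membership of all \<open>[x, y]\<close> in
  \<open>B\<close> to generators \<open>x\<close>.\<close>

lemma subgroup_commutator_preimage:
  assumes B: "subgroup B G" and y: "y \<in> carrier G"
  shows "subgroup {x \<in> carrier G. commutator G x y \<in> B} G"
proof (rule subgroupI)
  show "{x \<in> carrier G. commutator G x y \<in> B} \<noteq> {}"
    using y subgroup.one_closed[OF B] by (auto intro!: exI[of _ \<one>])
qed (use y B in \<open>auto simp: commutator_mult_left commutator_inv_left subgroup.m_closed
      subgroup.m_inv_closed\<close>)

text \<open>Moving \<open>y^n\<close> past one more \<open>x\<close> creates \<open>n\<close>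
  central commutators, and \<open>n\<close> plus \<open>n choose 2\<close> is
  \<open>Suc n choose 2\<close>.\<close>

lemma pow_mult_class2:
  assumes x: "x \<in> carrier G" and y: "y \<in> carrier G"
  shows "(x \<otimes> y) [^] (n::nat) = x [^] n \<otimes> y [^] n \<otimes> commutator G y x [^] (n choose 2)"
proof (induction n)
  case (Suc n)
  let ?c = "commutator G y x"
  note [simp] = x y
  have c: "?c [^] k \<otimes> w = w \<otimes> ?c [^] k" if [simp]: "w \<in> carrier G" for k :: nat and w
    using commutator_central[of y x w] group_commutes_pow[of ?c w k] by simp
  have yx: "y [^] n \<otimes> x = ?c [^] n \<otimes> (x \<otimes> y [^] n)"
    using commutator_swap[of "y [^] n" x] by (simp add: commutator_pow_left)
  have "(x \<otimes> y) [^] Suc n = x [^] n \<otimes> y [^] n \<otimes> (x \<otimes> y \<otimes> ?c [^] (n choose 2))"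
    by (simp add: Suc m_assoc c)
  also have "\<dots> = x [^] n \<otimes> (y [^] n \<otimes> x) \<otimes> y \<otimes> ?c [^] (n choose 2)"
    by (simp add: m_assoc)
  also have "\<dots> = x [^] n \<otimes> (x \<otimes> y [^] n \<otimes> ?c [^] n) \<otimes> y \<otimes> ?c [^] (n choose 2)"
    unfolding yx by (simp add: c)
  also have "\<dots> = x [^] n \<otimes> x \<otimes> y [^] n \<otimes> (?c [^] n \<otimes> y) \<otimes> ?c [^] (n choose 2)"
    by (simp add: m_assoc)
  also have "\<dots> = x [^] Suc n \<otimes> y [^] Suc n \<otimes> (?c [^] n \<otimes> ?c [^] (n choose 2))"
    unfolding c[OF y] by (simp add: m_assoc)
  also have "?c [^] n \<otimes> ?c [^] (n choose 2) = ?c [^] (Suc n choose 2)"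
    by (simp add: nat_pow_mult numeral_2_eq_2)
  finally show ?case .
qed (simp add: numeral_2_eq_2)

lemma derived_central:
  assumes "x \<in> derived G (carrier G)" "w \<in> carrier G"
  shows "x \<otimes> w = w \<otimes> x"
proof -
  have "x \<in> generate G (derived_set G (carrier G))"
    using assms(1) by (simp add: derived_def)
  moreover have "derived_set G (carrier G) \<subseteq> carrier G"
    by (rule derived_set_in_carrier) simp
  ultimately have "x \<in> carrier G \<and> x \<otimes> w = w \<otimes> x"
  proof (induction rule: generate.induct)
    case (incl h)
    then show ?case using assms(2) commutator_central by (auto simp: commutator_def)
  next
    case (inv h)
    then obtain s t where st: "s \<in> carrier G" "t \<in> carrier G" "h = commutator G s t"
      by (auto simp: commutator_def)
    then show ?case
      using assms(2) commutator_central[of t s w] by (simp add: inv_commutator)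
  next
    case (eng h1 h2)
    then show ?case using assms(2) by (simp add: m_assoc) (simp add: m_assoc[symmetric])
  qed (use assms(2) in simp)
  then show ?thesis by blast
qed

end

section \<open>Finite \<open>p\<close>-groups\<close>

text \<open>A prime \<open>q\<close> dividing the part of the order prime to \<open>p\<close> would,
  by Sylow with exponent 1, give a subgroup of order \<open>q\<close>; a nontrivial element of it
  has order dividing both \<open>q\<close> and a power of \<open>p\<close>.\<close>

lemma (in group) finite_p_group_if_p_torsion:
  assumes p: "Factorial_Ring.prime p" and fin: "finite (carrier G)"
    and tors: "\<And>x. x \<in> carrier G \<Longrightarrow> \<exists>n. x [^] (p ^ n) = \<one>"
  shows "finite_p_group p G"
proof -
  have "order G \<noteq> 0"
    using fin by (simp add: order_gt_0_iff_finite[symmetric])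
  then obtain k m where km: "order G = p ^ k * m" "\<not> p dvd m"
    using prime_power_canonical[OF p] by (metis mult.commute neq0_conv)
  have "m = 1"
  proof (rule ccontr)
    assume "m \<noteq> 1"
    then obtain q where q: "Factorial_Ring.prime q" "q dvd m"
      using prime_factor_nat by blast
    have "q dvd order G" using km q(2) by simp
    then obtain r where "order G = q ^ 1 * r" by (auto elim: dvdE)
    then obtain Q where Q: "subgroup Q G" "card Q = q ^ 1"
      using sylow_thm[OF q(1) is_group _ fin] by blast
    have "Q \<noteq> {\<one>}" using Q(2) prime_gt_1_nat[OF q(1)] by auto
    then obtain x where x: "x \<in> Q" "x \<noteq> \<one>"
      using subgroup.one_closed[OF Q(1)] by blast
    have xc: "x \<in> carrier G" using subgroup.mem_carrier[OF Q(1) x(1)] .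
    interpret Q: group "G\<lparr>carrier := Q\<rparr>" using subgroup_imp_group[OF Q(1)] .
    have "x [^] q = \<one>"
      using Q.pow_order_eq_1[of x] x(1) Q(2) nat_pow_consistent[of x q Q] by (simp add: order_def)
    then have "ord x dvd q" using xc pow_eq_id by blast
    moreover obtain n where "x [^] (p ^ n) = \<one>" using tors[OF xc] by blast
    then have "ord x dvd p ^ n" using xc pow_eq_id by blast
    moreover have "coprime q (p ^ n)"
      using km(2) q p by (metis coprime_power_right_iff primes_coprime)
    ultimately have "ord x = 1" by (metis coprime_common_divisor_nat nat_dvd_1_iff_1 coprime_def)
    then show False using x(2) xc pow_eq_id[of x 1] by simp
  qed
  then show ?thesis using km by (auto simp: finite_p_group_def)
qed

text \<open>Modulo \<open>A\<close> the elements \<open>u \<otimes> x\<close> and \<open>x\<close>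
  agree; this is stated without passing to the quotient.\<close>

lemma (in group) normal_mult_pow:
  assumes A: "A \<lhd> G" and u: "u \<in> A" and x: "x \<in> carrier G"
  shows "\<exists>v\<in>A. (u \<otimes> x) [^] (n::nat) = v \<otimes> x [^] n"
proof (induction n)
  case 0
  show ?case using normal_imp_subgroup[OF A] by (auto intro!: bexI[of _ \<one>] simp: subgroup.one_closed)
next
  case (Suc n)
  then obtain v where v: "v \<in> A" "(u \<otimes> x) [^] n = v \<otimes> x [^] n" by blast
  note sub = normal_imp_subgroup[OF A]
  note [simp] = subgroup.mem_carrier[OF sub v(1)] subgroup.mem_carrier[OF sub u] x
  have "x [^] n \<otimes> u \<otimes> inv (x [^] n) \<in> A"
    using A u by (intro normal.inv_op_closed2) simp_all
  then have "v \<otimes> (x [^] n \<otimes> u \<otimes> inv (x [^] n)) \<in> A"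
    using subgroup.m_closed[OF sub v(1)] by blast
  moreover have "(u \<otimes> x) [^] Suc n
      = v \<otimes> (x [^] n \<otimes> u \<otimes> inv (x [^] n)) \<otimes> x [^] Suc n"
  proof -
    have "inv (x [^] n) \<otimes> (x \<otimes> x [^] n) = x"
      by (metis inv_cancel_left(1) nat_pow_closed nat_pow_Suc nat_pow_Suc2 x)
    then show ?thesis by (simp add: v m_assoc)
  qed
  ultimately show ?case by blast
qed

text \<open>The witness is \<open>A\<close> times the cyclic group of \<open>s\<close>. It is normal
  because \<open>s\<close> is central modulo \<open>A\<close>, and the \<open>p^m\<close>-th power
  of each of its elements falls into \<open>A\<close>.\<close>

lemma (in group) p_torsion_normal_extend:
  assumes A: "A \<lhd> G" and fin: "finite A"
    and tors: "\<And>x. x \<in> A \<Longrightarrow> \<exists>n. x [^] (p ^ n) = \<one>"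
    and s: "s \<in> carrier G" and ps: "s [^] (p ^ m) = \<one>" and p: "p > (0::nat)"
    and comm: "\<And>x. x \<in> carrier G \<Longrightarrow> commutator G x s \<in> A"
  shows "\<exists>B. B \<lhd> G \<and> finite B \<and> (\<forall>x\<in>B. \<exists>n. x [^] (p ^ n) = \<one>) \<and> A \<subseteq> B \<and> s \<in> B"
proof -
  let ?S = "generate G {s}"
  let ?B = "A <#> ?S"
  note sub = normal_imp_subgroup[OF A]
  have "ord s dvd p ^ m" using ps s by (simp add: pow_eq_id)
  then have ord: "ord s \<noteq> 0" using p by (intro notI) simp
  have S: "subgroup ?S G" using s by (intro generate_is_subgroup) simp
  have S_pow: "?S = {s [^] k |k. k \<in> (UNIV :: nat set)}"
    by (rule generate_pow_nat[OF s ord])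
  have finS: "finite ?S"
    using ord generate_pow_card[OF s] card.infinite by fastforce
  have B: "subgroup ?B G" by (rule mult_norm_subgroup[OF A S])
  have Bmem: "x \<in> ?B \<longleftrightarrow> (\<exists>u\<in>A. \<exists>k::nat. x = u \<otimes> s [^] k)" for x
    unfolding S_pow set_mult_def by blast
  have AB: "A \<subseteq> ?B"
  proof
    fix u assume "u \<in> A"
    then show "u \<in> ?B" unfolding Bmem
      using subgroup.mem_carrier[OF sub] by (intro bexI[of _ u] exI[of _ 0]) simp_all
  qed
  have sB: "s \<in> ?B" unfolding Bmem
    using s subgroup.one_closed[OF sub] by (intro bexI[of _ \<one>] exI[of _ 1]) simp_all
  have "finite ?B"
    using fin finS unfolding set_mult_def by simp
  moreover have "?B \<lhd> G"
    unfolding normal_inv_iff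
  proof (intro conjI ballI B)
    fix x h assume x: "x \<in> carrier G" and "h \<in> ?B"
    then obtain u k where u: "u \<in> A" and h: "h = u \<otimes> s [^] (k::nat)" unfolding Bmem by blast
    note [simp] = x s subgroup.mem_carrier[OF sub u]
    have "x \<otimes> s \<otimes> inv x = commutator G x s \<otimes> s"
      by (simp add: commutator_def m_assoc)
    then have "x \<otimes> s \<otimes> inv x \<in> ?B"
      using AB sB comm[OF x] subgroup.m_closed[OF B] by fastforce
    then have pw: "(x \<otimes> s \<otimes> inv x) [^] k \<in> ?B" for k :: nat
      by (induction k) (auto intro: subgroup.one_closed[OF B] subgroup.m_closed[OF B])
    have conj: "(x \<otimes> s \<otimes> inv x) [^] k = x \<otimes> s [^] k \<otimes> inv x" for k :: nat
      by (induction k) (simp_all add: m_assoc)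
    have "x \<otimes> u \<otimes> inv x \<in> ?B"
      using AB normal.inv_op_closed2[OF A x u] by blast
    then have "(x \<otimes> u \<otimes> inv x) \<otimes> (x \<otimes> s [^] k \<otimes> inv x) \<in> ?B"
      using pw[of k] unfolding conj by (rule subgroup.m_closed[OF B])
    then show "x \<otimes> h \<otimes> inv x \<in> ?B"
      by (simp add: h m_assoc)
  qed
  moreover have "\<exists>n. x [^] (p ^ n) = \<one>" if xB: "x \<in> ?B" for x
  proof -
    obtain u k where u: "u \<in> A" and x: "x = u \<otimes> s [^] (k::nat)" using xB unfolding Bmem by blast
    obtain v where v: "v \<in> A" and "x [^] (p ^ m) = v \<otimes> (s [^] k) [^] (p ^ m)"
      using normal_mult_pow[OF A u, of "s [^] k" "p ^ m"] s x by auto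
    moreover have "(s [^] k) [^] (p ^ m) = \<one>"
      using ps s by (simp add: nat_pow_pow mult.commute[of k] nat_pow_pow[symmetric])
    ultimately have "x [^] (p ^ m) = v" using subgroup.mem_carrier[OF sub v] by simp
    moreover obtain n where "v [^] (p ^ n) = \<one>" using tors[OF v] by blast
    moreover have "x \<in> carrier G" using xB subgroup.mem_carrier[OF B] by blast
    ultimately have "x [^] (p ^ (m + n)) = \<one>"
      by (simp add: power_add nat_pow_pow[symmetric])
    then show ?thesis by blast
  qed
  ultimately show ?thesis using AB sB by blast
qed

lemma (in group) p_torsion_normal_extend_set:
  assumes "finite S" and A: "A \<lhd> G" "finite A" "\<forall>x\<in>A. \<exists>n. x [^] (p ^ n) = \<one>"
    and p: "p > (0::nat)"
    and "S \<subseteq> carrier G" "\<forall>s\<in>S. \<exists>m. s [^] (p ^ m) = \<one>"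
    and "\<forall>s\<in>S. \<forall>x\<in>carrier G. commutator G x s \<in> A"
  shows "\<exists>B. B \<lhd> G \<and> finite B \<and> (\<forall>x\<in>B. \<exists>n. x [^] (p ^ n) = \<one>) \<and> A \<union> S \<subseteq> B"
  using assms(1,6-8)
proof (induction S)
  case empty
  then show ?case using A by auto
next
  case (insert s S)
  then obtain B where B: "B \<lhd> G" "finite B" "\<forall>x\<in>B. \<exists>n. x [^] (p ^ n) = \<one>" "A \<union> S \<subseteq> B"
    by auto
  obtain m where m: "s [^] (p ^ m) = \<one>" using insert.prems by auto
  have "\<exists>C. C \<lhd> G \<and> finite C \<and> (\<forall>x\<in>C. \<exists>n. x [^] (p ^ n) = \<one>) \<and> B \<subseteq> C \<and> s \<in> C"
    using insert.prems B m p by (intro p_torsion_normal_extend) auto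
  then show ?case using B by blast
qed

section \<open>The central amalgam\<close>

text \<open>The common setting of both cases: \<open>M\<close> is represented by
  \<open>H \<inter> generate G {z}\<close>, and a choice of its generator is added later.\<close>

locale H_amalgam = group G for G (structure) +
  fixes p :: nat and H :: "'a set" and g :: "gen4 \<Rightarrow> 'a" and z :: 'a
  assumes prime: "Factorial_Ring.prime p" and odd: "odd p"
    and subgroup_H: "subgroup H G"
    and presentation: "has_presentation (G\<lparr>carrier := H\<rparr>) g (H_relations p)"
    and z_closed [simp, intro]: "z \<in> carrier G" and ord_z: "ord z = p\<^sup>2"
    and z_commutes: "\<forall>h\<in>H. z \<otimes> h = h \<otimes> z"
    and carrier_eq: "carrier G = H <#> generate G {z}"
    and card_int: "card (H \<inter> generate G {z}) = p"
begin

abbreviation val :: "gen4 word \<Rightarrow> 'a" where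
  "val \<equiv> word_val G g"

lemma g_mem_H: "g x \<in> H"
  and H_eq: "H = range val"
  and val_eq_iff: "val u = val v \<longleftrightarrow> word_eq (H_relations p) u v"
  using has_presentation_word_val[OF presentation subgroup_H] by auto

lemma g_closed [simp, intro]: "g x \<in> carrier G"
  using g_mem_H subgroup.mem_carrier[OF subgroup_H] by blast

lemmas val_simps [simp] =
  word_val_closed[of g, OF g_closed] word_val_append[of g, OF g_closed]
  word_val_gen[of g, OF g_closed] word_val_inv[of g, OF g_closed]
  word_val_pow[of g, OF g_closed] word_val_comm[of g, OF g_closed]

lemma val_mem_H [simp]: "val w \<in> H"
  using H_eq by blast

lemma p_gt_1: "p > 1"
  using prime_gt_1_nat[OF prime] .

lemma generate_z: "generate G {z} = {z [^] k |k. k \<in> (UNIV :: nat set)}"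
  using p_gt_1 ord_z by (intro generate_pow_nat) auto

lemma carrier_cases:
  assumes "x \<in> carrier G"
  obtains w and n :: nat where "x = val w \<otimes> z [^] n"
  using assms unfolding carrier_eq set_mult_def generate_z H_eq by blast

lemma z_pow_central_H: "h \<in> H \<Longrightarrow> z [^] (n::nat) \<otimes> h = h \<otimes> z [^] n"
  using z_commutes group_commutes_pow[of z h n] subgroup.mem_carrier[OF subgroup_H] by auto

lemma z_pow_central:
  assumes "x \<in> carrier G"
  shows "z [^] (n::nat) \<otimes> x = x \<otimes> z [^] n"
proof -
  obtain w and k :: nat where x: "x = val w \<otimes> z [^] k" using carrier_cases[OF assms] .
  have "z [^] n \<otimes> (val w \<otimes> z [^] k) = val w \<otimes> (z [^] n \<otimes> z [^] k)"
    using z_pow_central_H[of "val w" n] by (simp add: m_assoc[symmetric])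
  also have "\<dots> = val w \<otimes> z [^] k \<otimes> z [^] n"
    by (simp add: nat_pow_mult add.commute m_assoc)
  finally show ?thesis by (simp add: x)
qed

lemma z_central: "x \<in> carrier G \<Longrightarrow> z \<otimes> x = x \<otimes> z"
  using z_pow_central[of x 1] by simp

lemma inv_z_pow:
  obtains r :: nat where "inv (z [^] (n::nat)) = z [^] r"
proof -
  have "inv (z [^] n) \<in> generate G {z}"
    using generate_z subgroup.m_inv_closed[OF generate_is_subgroup[of "{z}"]] by auto
  then show thesis using that unfolding generate_z by blast
qed

lemma mult_val_z:
  "val u \<otimes> z [^] (m::nat) \<otimes> (val v \<otimes> z [^] (n::nat)) = val (u @ v) \<otimes> z [^] (m + n)"
proof -
  have "z [^] m \<otimes> (val v \<otimes> z [^] n) = val v \<otimes> (z [^] m \<otimes> z [^] n)"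
    using z_pow_central[of "val v" m] by (simp add: m_assoc[symmetric])
  then show ?thesis by (simp add: m_assoc nat_pow_mult)
qed

lemma pow_val_z: "(val u \<otimes> z [^] (m::nat)) [^] (n::nat) = val (word_pow u n) \<otimes> z [^] (m * n)"
  using z_pow_central[of "val u" m] by (simp add: pow_mult_distrib nat_pow_pow)

lemma commutator_val_z:
  "commutator G (val u \<otimes> z [^] (m::nat)) (val v \<otimes> z [^] (n::nat)) = val (word_comm u v)"
  using z_pow_central by (simp add: commutator_mult_central)

lemma commutator_cases:
  assumes "x \<in> carrier G" "y \<in> carrier G"
  obtains u v where "commutator G x y = val (word_comm u v)"
  using assms commutator_val_z by (metis carrier_cases)

text \<open>Commutators in \<open>G\<close> are commutators of words, since powers of
  \<open>z\<close> drop out, so class two passes from \<open>H\<close> to \<open>G\<close>.\<close>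

sublocale class2_group G
proof
  fix x y w assume x: "x \<in> carrier G" and y: "y \<in> carrier G" and w: "w \<in> carrier G"
  obtain u v where c: "commutator G x y = val (word_comm u v)" using commutator_cases[OF x y] .
  obtain t and n :: nat where w: "w = val t \<otimes> z [^] n" using carrier_cases[OF w] .
  have "val (word_comm (word_comm u v) t) = val []"
    unfolding val_eq_iff by (rule word_eq.rel[OF comm_mem_H_relations])
  then have "commutator G (val (word_comm u v)) (val t) = \<one>"
    unfolding word_val_comm[of g, OF g_closed, of "word_comm u v"] by simp
  then have "commutator G (val (word_comm u v)) w = \<one>"
    unfolding w using z_pow_central
    by (subst commutator_mult_central(2)) (simp_all del: word_val_comm)
  then show "commutator G x y \<otimes> w = w \<otimes> commutator G x y"
    unfolding c w by (subst (asm) commutator_eq_one_iff) simp_all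
qed

lemma g_pow:
  "g x [^] p = commutator G (val (fst (power_relation x))) (val (snd (power_relation x)))"
proof -
  have "val (word_pow (word_gen x) p)
      = val (word_comm (fst (power_relation x)) (snd (power_relation x)))"
    unfolding val_eq_iff by (rule word_eq.rel[OF pow_mem_H_relations])
  then show ?thesis by simp
qed

lemma g_pow_central: "w \<in> carrier G \<Longrightarrow> g x [^] p \<otimes> w = w \<otimes> g x [^] p"
  unfolding g_pow by (rule commutator_central) simp_all

text \<open>The \<open>p\<close>-th power moves into the first entry, and \<open>g x [^] p\<close>
  is central, being itself a commutator.\<close>

lemma commutator_g_pow: "w \<in> carrier G \<Longrightarrow> commutator G (g x) w [^] p = \<one>"
  using g_pow_central[of w x]
  by (simp add: commutator_pow_left[symmetric] commutator_eq_one_iff)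

lemma subset_of_generators:
  assumes L: "subgroup L G" and "\<And>x. g x \<in> L" and "z \<in> L"
  shows "carrier G \<subseteq> L"
proof
  fix x assume "x \<in> carrier G"
  then obtain w and n :: nat where x: "x = val w \<otimes> z [^] n" by (rule carrier_cases)
  have "val w \<in> L" using assms by (intro word_val_mem_subgroup) simp_all
  moreover have "z [^] n \<in> L" using assms(3) L
    by (induction n) (simp_all add: subgroup.one_closed subgroup.m_closed)
  ultimately show "x \<in> L" unfolding x by (rule subgroup.m_closed[OF L])
qed

text \<open>Such a power lies in an intersection of order \<open>p\<close>, so
  \<open>z^(n p) = 1\<close> and \<open>p^2\<close> divides \<open>n p\<close>.\<close>

lemma z_pow_mem_int:
  assumes "z [^] (n::nat) \<in> H"
  shows "p dvd n"
proof -
  let ?M = "H \<inter> generate G {z}"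
  have M: "subgroup ?M G"
    using subgroup_H by (intro subgroups_Inter_pair generate_is_subgroup) simp_all
  interpret M: group "G\<lparr>carrier := ?M\<rparr>" using subgroup_imp_group[OF M] .
  have "z [^] n \<in> ?M" using assms unfolding generate_z by blast
  then have "(z [^] n) [^] p = \<one>"
    using M.pow_order_eq_1[of "z [^] n"] card_int nat_pow_consistent[of "z [^] n" p ?M]
    by (simp add: order_def)
  then have "p\<^sup>2 dvd n * p" using ord_z by (simp add: nat_pow_pow pow_eq_id)
  then show ?thesis using p_gt_1 by (simp add: power2_eq_square)
qed

lemma z_not_mem_H: "z \<notin> H"
  using z_pow_mem_int[of 1] p_gt_1 by auto

text \<open>A nontrivial element of the intersection is \<open>z^(p j)\<close> with \<open>j\<close>
  prime to \<open>p\<close>; raising it to an inverse \<open>i\<close> of \<open>j\<close> modulo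
  \<open>p\<close> gives \<open>z^p\<close>.\<close>

lemma z_pow_p_mem: "z [^] p \<in> H \<inter> generate G {z}"
proof -
  let ?M = "H \<inter> generate G {z}"
  have M: "subgroup ?M G"
    using subgroup_H by (intro subgroups_Inter_pair generate_is_subgroup) simp_all
  have "?M \<noteq> {\<one>}" using card_int p_gt_1 by auto
  then obtain m where m: "m \<in> ?M" "m \<noteq> \<one>" using subgroup.one_closed[OF M] by blast
  then obtain n :: nat where n: "m = z [^] n" unfolding generate_z by blast
  then obtain j where j: "n = p * j" using m z_pow_mem_int by blast
  have "\<not> p dvd j"
  proof
    assume "p dvd j"
    then have "p\<^sup>2 dvd n" unfolding j power2_eq_square by simp
    then show False using m(2) n ord_z pow_eq_id by simp
  qed
  then have "coprime j p" using prime by (metis coprime_commute prime_imp_coprime)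
  then obtain i y where "j * i = p * y + 1"
    using bezout_nat[of j p] \<open>\<not> p dvd j\<close> by (metis coprime_imp_gcd_eq_1 dvd_0_right)
  then have "n * i = p\<^sup>2 * y + p"
    unfolding j power2_eq_square by (metis (no_types) distrib_left mult.assoc nat_mult_1_right)
  then have "m [^] i = z [^] p"
    using pow_ord_eq_1[of z] unfolding n ord_z
    by (simp add: nat_pow_pow nat_pow_mult[symmetric]) (simp add: nat_pow_pow[symmetric])
  moreover have "m [^] i \<in> ?M"
    using subgroup_int_pow_closed[OF M m(1), of "int i"] by (simp add: int_pow_int)
  ultimately show ?thesis by simp
qed

text \<open>Its \<open>twist\<close> coordinate is \<open>2 p\<close>, which \<open>p^2\<close> does
  not divide because \<open>p\<close> is odd.\<close>

lemma commutator_GA_GB_ne_one: "commutator G (g GA) (g GB) \<noteq> \<one>"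
proof
  assume "commutator G (g GA) (g GB) = \<one>"
  then have "val (word_comm (word_gen GA) (word_gen GB)) = val []" by simp
  then have "(int p)\<^sup>2 dvd twist p GA GB (word_comm (word_gen GA) (word_gen GB)) - twist p GA GB []"
    unfolding val_eq_iff using word_eq_invariants by blast
  then have "int p * int p dvd int p * 2"
    by (simp add: twist_comm minor_def word_gen_def word_vec_single power2_eq_square)
  then have "int p dvd 2" using p_gt_1 by simp
  then have "p dvd 2" by presburger
  then have "p = 2" using p_gt_1 dvd_imp_le[of p 2] by simp
  then show False using odd by simp
qed

lemma derived_subset_H: "derived G (carrier G) \<subseteq> H"
proof (rule derived_subset_subgroup[OF subgroup_H])
  fix x y assume "x \<in> carrier G" "y \<in> carrier G"
  then obtain u v where "commutator G x y = val (word_comm u v)" by (rule commutator_cases)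
  then show "commutator G x y \<in> H" by (metis val_mem_H)
qed

lemma z_not_mem_derived: "z \<notin> derived G (carrier G)"
  using derived_subset_H z_not_mem_H by blast

lemma not_special: "\<not> special_p_group p G"
  using z_not_mem_derived z_central by (auto simp: special_p_group_def center_def)

lemma finite_G: "finite (carrier G)"
  and finite_p_group_G: "finite_p_group p G"
proof -
  let ?tors = "\<lambda>B. \<forall>x\<in>B. \<exists>n. x [^] (p ^ n) = \<one>"
  let ?C = "(\<lambda>(i, j). commutator G (g i) (g j)) ` UNIV"
  have p0: "p > 0" using p_gt_1 by simp
  have U: "(UNIV :: gen4 set) = {GA, GB, GC, GD}" using gen4.exhaust by auto
  then have finU: "finite (UNIV :: gen4 set)" by (metis finite.emptyI finite.insertI)
  have finU2: "finite (UNIV :: (gen4 \<times> gen4) set)"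
    by (metis UNIV_Times_UNIV finU finite_cartesian_product)
  \<comment> \<open>First layer: the commutators of generators are central with trivial
    \<open>p\<close>-th power.\<close>
  have "\<exists>B. B \<lhd> G \<and> finite B \<and> ?tors B \<and> {\<one>} \<union> ?C \<subseteq> B"
  proof (rule p_torsion_normal_extend_set)
    show "finite ?C" using finU2 by simp
    show "{\<one>} \<lhd> G" by (simp add: normal_inv_iff triv_subgroup)
    show "\<forall>s\<in>?C. \<exists>m. s [^] (p ^ m) = \<one>"
    proof
      fix s assume "s \<in> ?C"
      then have "s [^] (p ^ 1) = \<one>" using commutator_g_pow by auto
      then show "\<exists>m. s [^] (p ^ m) = \<one>" by blast
    qed
    show "\<forall>s\<in>?C. \<forall>x\<in>carrier G. commutator G x s \<in> {\<one>}"
      using commutator_central by (auto simp: commutator_eq_one_iff)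
  qed (use p0 in auto)
  then obtain B where B: "B \<lhd> G" "finite B" "?tors B" "?C \<subseteq> B" by blast
  note subB = normal_imp_subgroup[OF B(1)]
  have Bz: "commutator G x z \<in> B" if "x \<in> carrier G" for x
    using that z_central[of x] subgroup.one_closed[OF subB] commutator_eq_one_iff[of x z] by simp
  have Bz': "commutator G z x \<in> B" if "x \<in> carrier G" for x
    using that z_central[of x] subgroup.one_closed[OF subB] commutator_eq_one_iff[of z x] by simp
  have Bg: "commutator G x (g j) \<in> B" if "x \<in> carrier G" for x j
  proof -
    have "carrier G \<subseteq> {x \<in> carrier G. commutator G x (g j) \<in> B}"
      using B(4) Bz'[of "g j"]
      by (intro subset_of_generators subgroup_commutator_preimage[OF subB]) auto
    then show ?thesis using that by blast
  qed
  \<comment> \<open>Second layer: modulo \<open>B\<close> the generators and \<open>z\<close> are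
    central, and their \<open>p^2\<close>-th powers are trivial.\<close>
  have "\<exists>E. E \<lhd> G \<and> finite E \<and> ?tors E \<and> B \<union> insert z (range g) \<subseteq> E"
  proof (rule p_torsion_normal_extend_set)
    show "finite (insert z (range g))" using finU by simp
    have "z [^] (p ^ 2) = \<one>" using ord_z pow_ord_eq_1[of z] by simp
    moreover have "g x [^] (p ^ 2) = \<one>" for x
    proof -
      \<comment> \<open>The first entry of each power relation is a single generator, the form in
        which \<open>commutator_g_pow\<close> applies.\<close>
      obtain i where i: "fst (power_relation x) = word_gen i" by (cases x) auto
      have "(g x [^] p) [^] p = \<one>" unfolding g_pow i by (simp add: commutator_g_pow)
      then show ?thesis by (simp add: nat_pow_pow power2_eq_square)
    qed
    ultimately show "\<forall>s\<in>insert z (range g). \<exists>m. s [^] (p ^ m) = \<one>" by blast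
    show "\<forall>s\<in>insert z (range g). \<forall>x\<in>carrier G. commutator G x s \<in> B"
      using Bz Bg by blast
  qed (use p0 B in auto)
  then obtain E where E: "E \<lhd> G" "finite E" "?tors E" "insert z (range g) \<subseteq> E" by blast
  have "carrier G \<subseteq> E"
    using E(4) by (intro subset_of_generators normal_imp_subgroup[OF E(1)]) auto
  then show "finite (carrier G)" "finite_p_group p G"
    using E p_gt_1 prime by (auto intro: finite_subset intro!: finite_p_group_if_p_torsion)
qed

end

section \<open>Endomorphisms that are trivial modulo the derived subgroup\<close>

lemma (in comm_group) word_val_eq_int_pow:
  assumes g [simp]: "\<And>x. g x \<in> carrier G"
  shows "word_val G g w = g GA [^] word_vec w GA \<otimes> g GB [^] word_vec w GB
    \<otimes> g GC [^] word_vec w GC \<otimes> g GD [^] word_vec w GD"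
proof (induction w)
  case (Cons l w)
  obtain x e where l: "l = (x, e)" by (cases l)
  have v: "word_vec (l # w) y = letter_vec l y + word_vec w y" for y
    by (simp add: word_vec_def)
  show ?case
    unfolding l word_val_Cons Cons.IH v[unfolded l]
    by (cases x; cases e) (simp_all add: int_pow_mult int_pow_diff m_ac)
qed simp

text \<open>Applied with \<open>y\<close> the image of \<open>x\<close>: a displacement
  \<open>y \<otimes> inv x\<close> commuting with \<open>x\<close> can be written on either
  side.\<close>

lemma (in group) inv_mult_commute:
  assumes [simp]: "x \<in> carrier G" "y \<in> carrier G"
    and c: "y \<otimes> inv x \<otimes> x = x \<otimes> (y \<otimes> inv x)"
  shows "inv x \<otimes> y = y \<otimes> inv x"
proof -
  have "inv x \<otimes> y = inv x \<otimes> (y \<otimes> inv x \<otimes> x)"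
    by (simp add: m_assoc)
  then show ?thesis unfolding c by simp
qed

context H_amalgam
begin

text \<open>In the abelian quotient a word depends only on its exponent sums, and each generator is
  killed by \<open>p\<close> because its \<open>p\<close>-th power is a commutator.\<close>

lemma val_mem_derived:
  assumes w: "\<And>x. int p dvd word_vec w x"
  shows "val w \<in> derived G (carrier G)"
proof -
  let ?D = "derived G (carrier G)"
  let ?q = "\<lambda>x. ?D #> x"
  interpret D: normal ?D G by (rule derived_self_is_normal)
  interpret Q: comm_group "G Mod ?D" by (rule derived_quot_is_comm_group)
  have q: "?q \<in> hom G (G Mod ?D)" by (rule D.r_coset_hom_Mod)
  have qg [simp]: "?q (g x) \<in> carrier (G Mod ?D)" for x
    using hom_in_carrier[OF q] by blast
  have pow: "?q (g x) [^]\<^bsub>G Mod ?D\<^esub> word_vec w x = \<one>\<^bsub>G Mod ?D\<^esub>" for x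
  proof -
    obtain k where k: "word_vec w x = int p * k" using w[of x] by blast
    have "g x [^] p \<in> ?D" unfolding g_pow by (rule commutator_mem_derived) simp_all
    then have "?q (g x [^] p) = ?D" by (simp add: D.rcos_const)
    then have "?q (g x) [^]\<^bsub>G Mod ?D\<^esub> p = \<one>\<^bsub>G Mod ?D\<^esub>"
      using hom_nat_pow[OF q, of "g x" p] by (simp add: one_FactGroup)
    then show ?thesis
      unfolding k Q.int_pow_pow[OF qg, symmetric] int_pow_int by (simp only: Q.int_pow_one)
  qed
  have "word_val (G Mod ?D) (\<lambda>x. ?q (g x)) w = \<one>\<^bsub>G Mod ?D\<^esub>"
    unfolding Q.word_val_eq_int_pow[OF qg] pow by (simp only: Q.r_one Q.one_closed)
  then have "?q (val w) = ?D"
    using word_val_hom[OF q Q.is_group, of g w] by (simp add: one_FactGroup)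
  then show ?thesis using rcos_self[of "val w" ?D] D.is_subgroup by simp
qed

text \<open>Each \<open>f x\<close> differs from \<open>x\<close> by a central factor, which
  commutators ignore.\<close>

lemma hom_fixes_derived:
  assumes f: "f \<in> hom G G"
    and triv: "\<And>x. x \<in> carrier G \<Longrightarrow> f x \<otimes> inv x \<in> derived G (carrier G)"
    and d: "d \<in> derived G (carrier G)"
  shows "f d = d"
proof -
  interpret f: group_hom G G f using f by (simp add: group_hom_def group_hom_axioms_def)
  have "derived G (carrier G) \<subseteq> {x \<in> carrier G. f x = x}"
  proof (rule derived_subset_subgroup)
    show "subgroup {x \<in> carrier G. f x = x} G"
      by (rule subgroupI) auto
    fix x y assume x: "x \<in> carrier G" and y: "y \<in> carrier G"
    have decomp: "f u = u \<otimes> (f u \<otimes> inv u)" "f u \<otimes> inv u \<in> carrier G" if "u \<in> carrier G" for u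
      using derived_central[OF triv[OF that] that] that by (simp_all add: m_assoc)
    have "commutator G (f x) (f y) = commutator G (x \<otimes> (f x \<otimes> inv x)) (y \<otimes> (f y \<otimes> inv y))"
      using decomp x y by metis
    also have "\<dots> = commutator G x y"
      using x y derived_central[OF triv] by (simp add: commutator_mult_central)
    finally show "commutator G x y \<in> {x \<in> carrier G. f x = x}"
      using x y by (simp add: commutator_def)
  qed
  then show ?thesis using d by blast
qed

text \<open>Each map fixes the displacement of the other, so both composites multiply
  \<open>x\<close> by the same two central displacements.\<close>

lemma trivial_mod_derived_commute:
  assumes f: "f \<in> hom G G" and h: "h \<in> hom G G"
    and ft: "\<And>x. x \<in> carrier G \<Longrightarrow> f x \<otimes> inv x \<in> derived G (carrier G)"
    and ht: "\<And>x. x \<in> carrier G \<Longrightarrow> h x \<otimes> inv x \<in> derived G (carrier G)"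
    and x: "x \<in> carrier G"
  shows "f (h x) = h (f x)"
proof -
  have [simp]: "f x \<in> carrier G" "h x \<in> carrier G"
    using x f h by (auto dest: hom_in_carrier)
  have "f (h x) = f (h x \<otimes> inv x) \<otimes> f x"
    using x by (subst hom_mult[OF f, symmetric]) (simp_all add: m_assoc)
  moreover have "h (f x) = h (f x \<otimes> inv x) \<otimes> h x"
    using x by (subst hom_mult[OF h, symmetric]) (simp_all add: m_assoc)
  moreover have "f (h x \<otimes> inv x) = h x \<otimes> inv x"
    by (rule hom_fixes_derived[OF f ft ht[OF x]])
  moreover have "h (f x \<otimes> inv x) = f x \<otimes> inv x"
    by (rule hom_fixes_derived[OF h ht ft[OF x]])
  ultimately have "f (h x) = (h x \<otimes> inv x) \<otimes> f x" "h (f x) = (f x \<otimes> inv x) \<otimes> h x"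
    by simp_all
  moreover have "(h x \<otimes> inv x) \<otimes> f x = f x \<otimes> (h x \<otimes> inv x)"
    by (rule derived_central[OF ht[OF x]]) simp
  moreover have "inv x \<otimes> h x = h x \<otimes> inv x"
    using x derived_central[OF ht[OF x]] by (intro inv_mult_commute) simp_all
  ultimately show ?thesis
    using x by (simp add: m_assoc)
qed

text \<open>Displacements are central and therefore multiplicative; triviality modulo the derived
  subgroup need only be checked on generators.\<close>

lemma subgroup_trivial_mod_derived:
  assumes f: "f \<in> hom G G"
  shows "subgroup {x \<in> carrier G. f x \<otimes> inv x \<in> derived G (carrier G)} G"
proof -
  let ?D = "derived G (carrier G)"
  have D: "subgroup ?D G" by (rule derived_is_subgroup) simp
  interpret f: group_hom G G f using f by (simp add: group_hom_def group_hom_axioms_def)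
  show ?thesis
  proof (rule subgroupI)
    show "{x \<in> carrier G. f x \<otimes> inv x \<in> ?D} \<noteq> {}"
      using subgroup.one_closed[OF D] by (auto intro!: exI[of _ \<one>])
    fix x assume "x \<in> {x \<in> carrier G. f x \<otimes> inv x \<in> ?D}"
    then have x [simp]: "x \<in> carrier G" and d: "f x \<otimes> inv x \<in> ?D" by auto
    have "f (inv x) \<otimes> inv (inv x) = inv (inv x \<otimes> f x)"
      by (simp add: inv_mult_group)
    also have "inv x \<otimes> f x = f x \<otimes> inv x"
      using derived_central[OF d] by (intro inv_mult_commute) simp_all
    finally show "inv x \<in> {x \<in> carrier G. f x \<otimes> inv x \<in> ?D}"
      using subgroup.m_inv_closed[OF D d] by simp
    fix y assume "y \<in> {x \<in> carrier G. f x \<otimes> inv x \<in> ?D}"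
    then have y [simp]: "y \<in> carrier G" and e: "f y \<otimes> inv y \<in> ?D" by auto
    have "f (x \<otimes> y) \<otimes> inv (x \<otimes> y) = f x \<otimes> ((f y \<otimes> inv y) \<otimes> inv x)"
      by (simp add: inv_mult_group m_assoc)
    also have "\<dots> = (f x \<otimes> inv x) \<otimes> (f y \<otimes> inv y)"
      using derived_central[OF e, of "inv x"] by (simp add: m_assoc)
    finally show "x \<otimes> y \<in> {x \<in> carrier G. f x \<otimes> inv x \<in> ?D}"
      using subgroup.m_closed[OF D d e] by simp
  qed auto
qed

end

section \<open>Rigidity for \<open>M = \<langle>[a, b]\<rangle>\<close>\<close>

primrec subst_word :: "('x \<Rightarrow> 'x word) \<Rightarrow> 'x word \<Rightarrow> 'x word" where
  "subst_word W [] = []"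
| "subst_word W (l # w) = (if snd l then W (fst l) else word_inv (W (fst l))) @ subst_word W w"

lemma subst_word_append [simp]: "subst_word W (u @ v) = subst_word W u @ subst_word W v"
  by (induction u) auto

lemma subst_word_gen [simp]: "subst_word W (word_gen x) = W x"
  by (simp add: word_gen_def)

locale H_amalgam_ab = H_amalgam +
  fixes k :: nat
  assumes z_pow_p: "z [^] p = commutator G (g GA) (g GB) [^] k"
begin

lemma not_dvd_k: "\<not> p dvd k"
proof
  assume "p dvd k"
  then obtain j where k: "k = p * j" by blast
  have "z [^] p = \<one>"
    unfolding z_pow_p k by (simp add: nat_pow_pow[symmetric] commutator_g_pow)
  then have "p ^ 2 \<le> p ^ 1" using ord_z p_gt_1 by (simp add: pow_eq_id dvd_imp_le)
  then have "(2::nat) \<le> 1" by (rule power_le_imp_le_exp[OF p_gt_1])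
  then show False by simp
qed

lemma z_pow_mem_derived:
  assumes "p dvd n"
  shows "z [^] n \<in> derived G (carrier G)"
proof -
  obtain j where n: "n = p * j" using assms by blast
  have "z [^] n = commutator G (g GA) (g GB) [^] (int (k * j))"
    unfolding n int_pow_int by (simp add: nat_pow_pow[symmetric] z_pow_p)
  also have "\<dots> \<in> derived G (carrier G)"
    by (intro subgroup_int_pow_closed derived_is_subgroup commutator_mem_derived) simp_all
  finally show ?thesis .
qed

lemma val_z_mem_derived:
  assumes "\<And>x. int p dvd word_vec w x" "p dvd n"
  shows "val w \<otimes> z [^] n \<in> derived G (carrier G)"
  using assms
  by (intro subgroup.m_closed[OF derived_is_subgroup] val_mem_derived z_pow_mem_derived) simp_all

definition minor_ab :: "gen4 \<Rightarrow> gen4 \<Rightarrow> int" where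
  "minor_ab i j = minor i j (word_vec (word_gen GA)) (word_vec (word_gen GB))"

text \<open>Extends the invariant of \<open>H\<close> to \<open>G\<close>: here
  \<open>n = p l\<close> and \<open>z^n = [a, b]^(k l)\<close>, whose \<open>twist\<close> is
  \<open>2 p k l = 2 n k\<close> times that of \<open>a \<and> b\<close>.\<close>

lemma relation_invariants:
  assumes "val u \<otimes> z [^] n = \<one>"
  shows "(int p)\<^sup>2 dvd twist p i j u + 2 * int n * int k * minor_ab i j"
proof -
  have "z [^] n = inv (val u)"
    using assms by (metis inv_equality nat_pow_closed val_simps(1) z_closed inv_inv)
  then have "z [^] n \<in> H" by (metis val_simps(4) val_mem_H)
  then obtain l where n: "n = p * l" using z_pow_mem_int by blast
  let ?c = "word_comm (word_gen GA) (word_gen GB)"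
  have "val (u @ word_pow ?c (k * l)) = val []"
    using assms unfolding n by (simp add: nat_pow_pow[symmetric] z_pow_p)
  then have "(int p)\<^sup>2 dvd twist p i j (u @ word_pow ?c (k * l)) - twist p i j []"
    unfolding val_eq_iff using word_eq_invariants by blast
  then show ?thesis
    by (simp add: twist_append twist_pow twist_comm minor_ab_def n minor_def algebra_simps)
qed

text \<open>The \<open>twist\<close> of both sides is divisible by \<open>p\<close>. Dividing by
  \<open>p\<close>, replacing \<open>twist\<close> of \<open>w\<close> by \<open>2 \<pi>\<close> via
  \<open>twist_mod\<close>, and cancelling 2 leaves a linear congruence modulo
  \<open>p\<close>.\<close>

lemma power_relation_invariants:
  assumes "(val w \<otimes> z [^] n) [^] p = val (word_pow (word_comm u v) l)"
  shows "int p dvd word_vec w GA * frob i j GA + word_vec w GB * frob i j GB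
     + word_vec w GC * frob i j GC + word_vec w GD * frob i j GD
     + int n * int k * minor_ab i j - int l * minor i j (word_vec u) (word_vec v)"
    (is "int p dvd ?s + _ - ?t")
proof -
  let ?r = "word_pow (word_comm u v) l"
  have "val (word_pow w p @ word_inv ?r) \<otimes> z [^] (n * p)
      = val (word_pow w p) \<otimes> z [^] (n * p) \<otimes> inv val ?r"
    using z_pow_central[of "inv val ?r" "n * p"]
    by (simp add: m_assoc del: val_simps(5,6))
  also have "\<dots> = \<one>" using assms unfolding pow_val_z by (simp del: val_simps(5,6))
  finally have "(int p)\<^sup>2 dvd twist p i j (word_pow w p @ word_inv ?r)
      + 2 * int (n * p) * int k * minor_ab i j"
    by (rule relation_invariants)
  then have "int p * int p dvd int p * (twist p i j w + 2 * (int n * int k * minor_ab i j - ?t))"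
    by (simp add: twist_append twist_pow twist_comm twist_inv minor_def power2_eq_square algebra_simps)
  then have "int p dvd twist p i j w + 2 * (int n * int k * minor_ab i j - ?t)"
    using p_gt_1 by simp
  then have "int p dvd twist p i j w + 2 * (int n * int k * minor_ab i j - ?t) - (twist p i j w - 2 * ?s)"
    using twist_mod by (rule dvd_diff)
  moreover have "twist p i j w + 2 * (int n * int k * minor_ab i j - ?t) - (twist p i j w - 2 * ?s)
      = 2 * (?s + int n * int k * minor_ab i j - ?t)"
    by (simp add: algebra_simps)
  ultimately have "int p dvd 2 * (?s + int n * int k * minor_ab i j - ?t)" by (simp only:)
  moreover have "coprime (int p) 2" using odd by simp
  ultimately show ?thesis by (simp only: coprime_dvd_mult_right_iff)
qed

text \<open>In the notation of \<open>rigidity_mod_prime\<close>, the exponent vectors of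
  \<open>W\<close> form the matrix of \<open>\<alpha>\<close>, the numbers \<open>N\<close> are the
  values of \<open>\<lambda>\<close>, and \<open>s\<close> is the exponent of \<open>z\<close> in
  \<open>f z\<close>.\<close>

lemma auto_trivial_mod_derived:
  assumes f: "f \<in> auto G" and x: "x \<in> carrier G"
  shows "f x \<otimes> inv x \<in> derived G (carrier G)"
proof -
  let ?D = "derived G (carrier G)"
  have D: "subgroup ?D G" by (rule derived_is_subgroup) simp
  have fh: "f \<in> hom G G" and bij: "bij_betw f (carrier G) (carrier G)"
    using f by (auto simp: auto_def Bij_def)
  interpret f: group_hom G G f using fh by (simp add: group_hom_def group_hom_axioms_def)
  have "\<forall>x. \<exists>w n. f (g x) = val w \<otimes> z [^] (n::nat)"
    by (metis carrier_cases f.hom_closed g_closed)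
  then obtain W N where fg: "\<And>x. f (g x) = val (W x) \<otimes> z [^] (N x :: nat)" by metis
  obtain Wz and s :: nat where fz: "f z = val Wz \<otimes> z [^] s"
    using carrier_cases[OF f.hom_closed[OF z_closed]] .
  \<comment> \<open>The unspecified power of \<open>z\<close> is harmless, since only commutators of
    these images are used.\<close>
  have fval: "\<exists>n::nat. f (val w) = val (subst_word W w) \<otimes> z [^] n" for w
  proof (induction w)
    case Nil
    show ?case by (auto intro: exI[of _ 0])
  next
    case (Cons l w)
    then obtain n :: nat where n: "f (val w) = val (subst_word W w) \<otimes> z [^] n" by blast
    obtain x e where l: "l = (x, e)" by (cases l)
    obtain n' :: nat where n': "inv (z [^] N x) = z [^] n'" using inv_z_pow .
    have "inv f (g x) = val (word_inv (W x)) \<otimes> z [^] n'"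
      using z_pow_central[of "inv val (W x)" n'] unfolding fg by (simp add: inv_mult_group n')
    then have "f (val (l # w)) = val (subst_word W (l # w)) \<otimes> z [^] ((if e then N x else n') + n)"
      using mult_val_z[of "W x" "N x" "subst_word W w" n]
        mult_val_z[of "word_inv (W x)" n' "subst_word W w" n]
      by (cases e) (simp_all add: l word_val_Cons n fg)
    then show ?case by blast
  qed
  have fcomm: "f (val (word_comm u v)) = val (word_comm (subst_word W u) (subst_word W v))" for u v
  proof -
    obtain n n' :: nat where "f (val u) = val (subst_word W u) \<otimes> z [^] n"
      and "f (val v) = val (subst_word W v) \<otimes> z [^] n'"
      using fval by metis
    moreover have "f (val (word_comm u v)) = commutator G (f (val u)) (f (val v))"
      by (simp add: commutator_def)
    ultimately show ?thesis by (simp only: commutator_val_z)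
  qed

  have rel: "int p dvd word_vec (W x) GA * frob i j GA + word_vec (W x) GB * frob i j GB
     + word_vec (W x) GC * frob i j GC + word_vec (W x) GD * frob i j GD
     + int (N x) * int k * minor_ab i j
     - minor i j (word_vec (subst_word W (fst (power_relation x))))
         (word_vec (subst_word W (snd (power_relation x))))" for x i j
  proof -
    have "(val (W x) \<otimes> z [^] N x) [^] p = f (g x [^] p)"
      by (simp add: f.hom_nat_pow fg)
    also have "\<dots> = f (val (word_comm (fst (power_relation x)) (snd (power_relation x))))"
      by (simp add: g_pow)
    also have "\<dots> = val (word_pow (word_comm (subst_word W (fst (power_relation x)))
        (subst_word W (snd (power_relation x)))) 1)"
      unfolding fcomm by simp
    finally show ?thesis using power_relation_invariants by fastforce
  qed

  \<comment> \<open>By surjectivity \<open>f z\<close> commutes with every generator, so the wedge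
    of its exponent vector with each basis vector vanishes modulo \<open>p\<close>.\<close>
  have central: "int p dvd minor i j (word_vec Wz) (word_vec (word_gen x))" for i j x
  proof -
    obtain y where y: "y \<in> carrier G" "g x = f y"
      using bij by (metis bij_betw_def g_closed imageE)
    have "f z \<otimes> f y = f y \<otimes> f z"
      using y z_central[OF y(1)] by (metis f.hom_mult z_closed)
    then have "commutator G (f z) (val (word_gen x) \<otimes> z [^] (0::nat)) = \<one>"
      using y by (simp add: commutator_eq_one_iff)
    then have "val (word_comm Wz (word_gen x)) \<otimes> z [^] (0::nat) = \<one>"
      unfolding fz commutator_val_z by simp
    then have "int p * int p dvd int p * (2 * minor i j (word_vec Wz) (word_vec (word_gen x)))"
      using relation_invariants[of "word_comm Wz (word_gen x)" 0 i j]
      by (simp add: twist_comm power2_eq_square mult.assoc mult.left_commute[of 2])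
    then have "int p dvd 2 * minor i j (word_vec Wz) (word_vec (word_gen x))"
      using p_gt_1 by simp
    moreover have "coprime (int p) 2" using odd by simp
    ultimately show ?thesis by (simp add: coprime_dvd_mult_right_iff)
  qed
  have vz: "int p dvd word_vec Wz x" for x
    using central[of GA GB GB] central[of GA GB GA] central[of GB GC GB] central[of GB GD GB]
    by (cases x) (simp_all add: minor_def word_gen_def word_vec_single)

  \<comment> \<open>Comes from applying \<open>f\<close> to \<open>z^p = [a, b]^k\<close> and
    cancelling the unit \<open>k\<close>.\<close>
  have relz: "int p dvd minor i j (word_vec (W GA)) (word_vec (W GB)) - int s * minor_ab i j" for i j
  proof -
    have "(val Wz \<otimes> z [^] s) [^] p = f (val (word_comm (word_gen GA) (word_gen GB))) [^] k"
      by (simp add: f.hom_nat_pow[symmetric] fz[symmetric] z_pow_p)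
    also have "\<dots> = val (word_pow (word_comm (W GA) (W GB)) k)"
      unfolding fcomm by simp
    finally have "int p dvd word_vec Wz GA * frob i j GA + word_vec Wz GB * frob i j GB
     + word_vec Wz GC * frob i j GC + word_vec Wz GD * frob i j GD
     + int s * int k * minor_ab i j - int k * minor i j (word_vec (W GA)) (word_vec (W GB))"
      (is "_ dvd ?s + ?t - ?u")
      by (rule power_relation_invariants)
    moreover have "int p dvd ?s" using vz by simp
    ultimately have "int p dvd ?s - (?s + ?t - ?u)" by (rule dvd_diff[rotated])
    then have "int p dvd int k * (minor i j (word_vec (W GA)) (word_vec (W GB)) - int s * minor_ab i j)"
      by (simp add: algebra_simps)
    moreover have "coprime (int p) (int k)"
      using not_dvd_k prime by (simp add: prime_imp_coprime)
    ultimately show ?thesis by (simp add: coprime_dvd_mult_right_iff)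
  qed

  have s: "\<not> p dvd s"
  proof
    assume "p dvd s"
    then have fzD: "f z \<in> ?D" unfolding fz using vz by (rule val_z_mem_derived[rotated])
    have "?D \<subseteq> f ` ?D"
    proof (rule derived_subset_subgroup[OF f.subgroup_img_is_subgroup[OF D]])
      fix u v assume "u \<in> carrier G" "v \<in> carrier G"
      then obtain u' v' where *: "u' \<in> carrier G" "u = f u'" "v' \<in> carrier G" "v = f v'"
        using bij by (metis bij_betw_def imageE)
      then have "commutator G u v = f (commutator G u' v')" by (simp add: commutator_def)
      then show "commutator G u v \<in> f ` ?D"
        using * by (auto intro: commutator_mem_derived)
    qed
    then obtain d where d: "d \<in> ?D" "f z = f d" using fzD by blast
    then have "z = d"
      using bij subgroup.mem_carrier[OF D d(1)] by (auto simp: bij_betw_def inj_on_def)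
    then show False using d z_not_mem_derived by simp
  qed

  let ?v = "\<lambda>x. word_vec (W x)"
  have minor_ab_simps: "minor_ab GA GB = 1" "minor_ab GA GC = 0"
      "minor_ab GA GD = 0" "minor_ab GB GC = 0" "minor_ab GB GD = 0"
    by (simp_all add: minor_ab_def minor_def word_gen_def word_vec_single)
  \<comment> \<open>Listed in the order of the hypotheses of
    \<open>rigidity_mod_prime\<close>.\<close>
  note rels = relz[of GA GB] relz[of GA GC] relz[of GA GD] relz[of GB GC] relz[of GB GD]
    rel[where x = GA and i = GA and j = GB] rel[where x = GA and i = GA and j = GC]
    rel[where x = GA and i = GA and j = GD] rel[where x = GA and i = GB and j = GC]
    rel[where x = GA and i = GB and j = GD]
    rel[where x = GB and i = GA and j = GB] rel[where x = GB and i = GA and j = GC]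
    rel[where x = GB and i = GA and j = GD]
    rel[where x = GC and i = GA and j = GB] rel[where x = GC and i = GA and j = GC]
    rel[where x = GC and i = GA and j = GD] rel[where x = GC and i = GB and j = GC]
    rel[where x = GC and i = GB and j = GD]
    rel[where x = GD and i = GA and j = GB] rel[where x = GD and i = GA and j = GC]
    rel[where x = GD and i = GA and j = GD] rel[where x = GD and i = GB and j = GD]
  note rels' = rels[unfolded minor_ab_simps frob_simps minor_def power_relation.simps fst_conv snd_conv
      subst_word_append subst_word_gen word_vec_append, simplified]
  have p2: "\<not> int p dvd 2"
  proof
    assume "int p dvd 2"
    then have "p dvd 2" by presburger
    then have "p = 2" using p_gt_1 dvd_imp_le[of p 2] by simp
    then show False using odd by simp
  qed
  have primes: "Factorial_Ring.prime (int p)" "\<not> int p dvd int k" "\<not> int p dvd int s"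
    using prime not_dvd_k s by simp_all
  note rigid = rigidity_mod_prime[OF primes(1) p2 primes(2,3) rels']
  have W: "int p dvd ?v x y - (if x = y then 1 else 0)" for x y
    using rigid by (cases x; cases y) simp_all
  have N: "p dvd N x" for x
    using rigid by (cases x) simp_all
  have s1: "int p dvd int s - 1" using rigid by simp
  have gD: "f (g x) \<otimes> inv g x \<in> ?D" for x
  proof -
    have "f (g x) \<otimes> inv g x = val (W x @ word_inv (word_gen x)) \<otimes> z [^] N x"
      using z_pow_central[of "inv g x" "N x"] by (simp add: fg m_assoc)
    moreover have "int p dvd word_vec (W x @ word_inv (word_gen x)) y" for y
      using W[of x y] by (auto simp: word_gen_def word_vec_single)
    ultimately show ?thesis using val_z_mem_derived N by metis
  qed
  have zD: "f z \<otimes> inv z \<in> ?D"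
  proof -
    \<comment> \<open>The exponent \<open>s - 1\<close> of the displacement must be a natural number
      before its divisibility by \<open>p\<close> can be used.\<close>
    have "s \<noteq> 0" using s by (metis dvd_0_right)
    then obtain t where t: "s = Suc t" using not0_implies_Suc by blast
    have "f z \<otimes> inv z = val Wz \<otimes> z [^] t"
      by (simp add: fz t m_assoc)
    then show ?thesis using val_z_mem_derived vz s1 by (simp add: t)
  qed
  have "carrier G \<subseteq> {x \<in> carrier G. f x \<otimes> inv x \<in> ?D}"
    using gD zD by (intro subset_of_generators subgroup_trivial_mod_derived[OF fh]) auto
  then show ?thesis using x by blast
qed

lemma miller_group_G: "miller_group G"
proof -
  have "comm_group (AutoGroup G)"
  proof (rule group.group_comm_groupI[OF AutoGroup])
    fix f h assume "f \<in> carrier (AutoGroup G)" "h \<in> carrier (AutoGroup G)"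
    then have f: "f \<in> auto G" and h: "h \<in> auto G" by (simp_all add: AutoGroup_def)
    then have hom: "f \<in> hom G G" "h \<in> hom G G" and Bij: "f \<in> Bij (carrier G)" "h \<in> Bij (carrier G)"
      by (auto simp: auto_def)
    have "compose (carrier G) f h = compose (carrier G) h f"
      unfolding compose_def
      by (intro restrict_ext trivial_mod_derived_commute hom auto_trivial_mod_derived f h)
    then show "f \<otimes>\<^bsub>AutoGroup G\<^esub> h = h \<otimes>\<^bsub>AutoGroup G\<^esub> f"
      using Bij by (simp add: AutoGroup_def BijGroup_def)
  qed
  moreover have "\<not> comm_group G"
  proof
    assume "comm_group G"
    then interpret comm_group G .
    show False
      using commutator_GA_GB_ne_one m_comm[of "g GA" "g GB"] by (simp add: commutator_eq_one_iff)
  qed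
  ultimately show ?thesis by (simp add: miller_group_def)
qed

end

section \<open>Non-commuting automorphisms for \<open>M = \<langle>[a, d]\<rangle>\<close>\<close>

context H_amalgam
begin

text \<open>The class two relations hold automatically in \<open>G\<close>, so \<open>rel\<close>
  suffices for a map on \<open>H\<close>; \<open>ad\<close> makes it agree with the identity on
  powers of \<open>z\<close> lying in \<open>H\<close>, so the two glue together.\<close>

lemma hom_extension:
  assumes g' [simp]: "\<And>x. g' x \<in> carrier G"
    and rel: "\<And>x. g' x [^] p = commutator G (word_val G g' (fst (power_relation x)))
        (word_val G g' (snd (power_relation x)))"
    and zk: "z [^] p = commutator G (g GA) (g GD) [^] (k::nat)"
    and ad: "commutator G (g' GA) (g' GD) = commutator G (g GA) (g GD)"
  obtains f where "f \<in> hom G G" "f z = z" "\<And>x. f (g x) = g' x"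
proof -
  let ?val = "word_val G g'"
  note [simp] = word_val_closed[of g', OF g'] word_val_append[of g', OF g']
    word_val_gen[of g', OF g'] word_val_inv[of g', OF g']
    word_val_pow[of g', OF g'] word_val_comm[of g', OF g']
  have cong: "?val u = ?val v" if "val u = val v" for u v
  proof (rule word_val_cong[of g', OF g'])
    show "word_eq (H_relations p) u v" using that val_eq_iff by blast
    fix u v assume "(u, v) \<in> H_relations p"
    then show "?val u = ?val v"
    proof (cases rule: H_relations_cases)
      case (comm x y w)
      then show ?thesis using commutator_central by (simp add: commutator_eq_one_iff)
    next
      case (pow x)
      then show ?thesis using rel by simp
    qed
  qed
  \<comment> \<open>A trivial product forces \<open>n = p l\<close>, so the power of
    \<open>z\<close> can be rewritten as a word in \<open>[a, d]\<close> and \<open>cong\<close>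
    applies.\<close>
  have kernel: "?val w \<otimes> z [^] n = \<one>" if one: "val w \<otimes> z [^] n = \<one>" for w and n :: nat
  proof -
    have "z [^] n = inv (val w)"
      using one by (metis inv_equality nat_pow_closed val_simps(1) z_closed inv_inv)
    then have "z [^] n \<in> H" by (metis val_simps(4) val_mem_H)
    then obtain l where n: "n = p * l" using z_pow_mem_int by blast
    let ?c = "word_comm (word_gen GA) (word_gen GD)"
    have "val (w @ word_pow ?c (k * l)) = val []"
      using one unfolding n by (simp add: nat_pow_pow[symmetric] zk)
    then have "?val (w @ word_pow ?c (k * l)) = ?val []" by (rule cong)
    then show ?thesis
      unfolding n by (simp add: nat_pow_pow[symmetric] zk ad)
  qed
  have wd: "?val u \<otimes> z [^] m = ?val v \<otimes> z [^] n"
    if eq: "val u \<otimes> z [^] m = val v \<otimes> z [^] n" for u v and m n :: nat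
  proof -
    obtain r :: nat where r: "inv (z [^] n) = z [^] r" using inv_z_pow .
    have "val (word_inv v @ u) \<otimes> z [^] (m + r) = inv val v \<otimes> (val u \<otimes> z [^] m) \<otimes> inv (z [^] n)"
      by (simp add: r nat_pow_mult[symmetric] m_assoc)
    also have "\<dots> = \<one>" unfolding eq by (simp add: m_assoc)
    finally have "?val (word_inv v @ u) \<otimes> z [^] (m + r) = \<one>" by (rule kernel)
    moreover have "?val (word_inv v @ u) \<otimes> z [^] (m + r)
        = inv ?val v \<otimes> (?val u \<otimes> z [^] m \<otimes> inv (z [^] n))"
      by (simp add: r nat_pow_mult[symmetric] m_assoc)
    ultimately have "?val u \<otimes> z [^] m \<otimes> inv (z [^] n) = ?val v"
      using inv_solve_left[of "\<one>" "?val v" "?val u \<otimes> z [^] m \<otimes> inv (z [^] n)"] by simp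
    then show ?thesis
      using inv_solve_right'[of "?val v" "?val u \<otimes> z [^] m" "z [^] n"] by simp
  qed
  have "\<forall>x\<in>carrier G. \<exists>wn. x = val (fst wn) \<otimes> z [^] (snd wn :: nat)"
    by (metis carrier_cases fst_conv snd_conv)
  then obtain W where W: "\<And>x. x \<in> carrier G \<Longrightarrow> x = val (fst (W x)) \<otimes> z [^] (snd (W x) :: nat)"
    by metis
  \<comment> \<open>Built from chosen representatives; \<open>wd\<close> makes the value independent
    of the choice.\<close>
  define f where "f x = ?val (fst (W x)) \<otimes> z [^] snd (W x)" for x
  have f: "f (val w \<otimes> z [^] n) = ?val w \<otimes> z [^] n" for w and n :: nat
    unfolding f_def by (rule wd, rule W[symmetric]) simp
  show thesis
  proof
    show "f \<in> hom G G"
    proof (rule homI)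
      show "f x \<in> carrier G" for x by (simp add: f_def)
      fix x y assume "x \<in> carrier G" "y \<in> carrier G"
      then obtain u v and m n :: nat
        where x: "x = val u \<otimes> z [^] m" and y: "y = val v \<otimes> z [^] n"
        by (metis carrier_cases)
      have "z [^] m \<otimes> (?val v \<otimes> z [^] n) = ?val v \<otimes> (z [^] m \<otimes> z [^] n)"
        using z_pow_central[of "?val v" m] by (simp add: m_assoc[symmetric])
      then show "f (x \<otimes> y) = f x \<otimes> f y"
        unfolding x y mult_val_z f by (simp add: m_assoc nat_pow_mult)
    qed
    show "f z = z" using f[of "[]" 1] by simp
    show "f (g x) = g' x" for x using f[of "word_gen x" 0] by simp
  qed
qed

text \<open>The image contains all generators, and a surjective endomorphism of a finite group is
  injective. The restriction supplies the extensionality built into \<open>auto\<close>.\<close>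

lemma restrict_auto:
  assumes f: "f \<in> hom G G" and gens: "\<And>x. g x \<in> f ` carrier G" "z \<in> f ` carrier G"
  shows "restrict f (carrier G) \<in> auto G"
proof -
  interpret f: group_hom G G f using f by (simp add: group_hom_def group_hom_axioms_def)
  have "carrier G \<subseteq> f ` carrier G"
    using gens by (intro subset_of_generators f.img_is_subgroup)
  then have im: "f ` carrier G = carrier G" by auto
  then have "inj_on f (carrier G)" using finite_G by (intro eq_card_imp_inj_on) simp_all
  then have "bij_betw f (carrier G) (carrier G)" using im by (simp add: bij_betw_def)
  moreover have "restrict f (carrier G) \<in> hom G G"
    using f by (auto simp: hom_def)
  ultimately show ?thesis by (simp add: auto_def Bij_def)
qed

lemma not_miller_group_G:
  assumes M: "H \<inter> generate G {z} = generate G {commutator G (g GA) (g GD)}"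
  shows "\<not> miller_group G"
proof
  assume miller: "miller_group G"
  define a b c d where "a = g GA" and "b = g GB" and "c = g GC" and "d = g GD"
  note abcd = a_def b_def c_def d_def
  have abcd_closed [simp]: "a \<in> carrier G" "b \<in> carrier G" "c \<in> carrier G" "d \<in> carrier G"
    by (simp_all add: abcd)
  let ?e = "commutator G a d"
  have ep: "?e [^] p = \<one>" by (simp add: abcd commutator_g_pow)
  then have "ord ?e \<noteq> 0" using pow_eq_id[of ?e p] p_gt_1 by (intro notI) simp
  then have "generate G {?e} = {?e [^] k |k. k \<in> (UNIV :: nat set)}"
    by (intro generate_pow_nat) simp_all
  then obtain k :: nat where k: "z [^] p = ?e [^] k"
    using z_pow_p_mem M unfolding abcd by auto
  have "?e \<in> H \<inter> generate G {z}"
    unfolding M abcd by (simp add: generate.incl)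
  then obtain i :: nat where i: "?e = z [^] i" "z [^] i \<in> H" unfolding generate_z by auto
  then obtain j where j: "i = p * j" using z_pow_mem_int by blast
  \<comment> \<open>A central \<open>p\<close>-th root of \<open>[a, d]\<close>, available because
    \<open>[a, d]\<close> lies in the group generated by \<open>z^p\<close>.\<close>
  define y where "y = z [^] j"
  have y [simp]: "y \<in> carrier G" and yp: "y [^] p = ?e"
    by (simp_all add: y_def i j nat_pow_pow mult.commute)
  have yc: "y \<otimes> x = x \<otimes> y" if "x \<in> carrier G" for x
    unfolding y_def using that by (rule z_pow_central)
  have pows: "a [^] p = commutator G a c"
      "b [^] p = commutator G a b \<otimes> commutator G a c \<otimes> ?e"
      "c [^] p = commutator G b c \<otimes> commutator G b d" "d [^] p = commutator G b d"
    using g_pow[of GA] g_pow[of GB] g_pow[of GC] g_pow[of GD]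
    by (simp_all add: abcd commutator_mult_right m_assoc)
  have commutators_y: "commutator G (u \<otimes> y) v = commutator G u v"
      "commutator G u (v \<otimes> y) = commutator G u v" if "u \<in> carrier G" "v \<in> carrier G" for u v
    using that yc by (simp_all add: commutator_mult_central)
  have comm_y: "commutator G u y = \<one>" if "u \<in> carrier G" for u
    using that yc by (simp add: commutator_eq_one_iff)
  have pow_y: "(u \<otimes> y) [^] p = u [^] p \<otimes> ?e" if "u \<in> carrier G" for u
    using that yc[of u] by (simp add: pow_mult_distrib yp)

  \<comment> \<open>For odd \<open>p\<close> the binomial coefficient \<open>p choose 2\<close> is a
    multiple of \<open>p\<close>, which kills the commutator correction.\<close>
  have cd: "(c \<otimes> d) [^] p = c [^] p \<otimes> d [^] p"
  proof -
    have "p choose 2 = p * ((p - 1) div 2)"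
      using odd by (simp add: choose_two div_mult_swap)
    then have "commutator G d c [^] (p choose 2) = \<one>"
      using commutator_g_pow[of c GD] by (simp add: d_def nat_pow_pow[symmetric])
    then show ?thesis by (simp add: pow_mult_class2)
  qed

  \<comment> \<open>The extra \<open>[a, d]\<close> in the \<open>p\<close>-th powers of
    \<open>a y\<close> and \<open>b y\<close> matches the replacement of \<open>c\<close> by
    \<open>c d\<close> in the second entries; for \<open>c d\<close> the extra factor is
    \<open>d^p = [b, d]\<close>.\<close>
  define g1 where "g1 = (\<lambda>x. case x of GA \<Rightarrow> a \<otimes> y | GB \<Rightarrow> b \<otimes> y | GC \<Rightarrow> c \<otimes> d | GD \<Rightarrow> d)"
  have g1: "g1 GA = a \<otimes> y" "g1 GB = b \<otimes> y" "g1 GC = c \<otimes> d" "g1 GD = d"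
    by (simp_all add: g1_def)
  have g1c: "g1 x \<in> carrier G" for x by (cases x) (simp_all add: g1)
  have rel1: "g1 x [^] p = commutator G (word_val G g1 (fst (power_relation x)))
        (word_val G g1 (snd (power_relation x)))" for x
    by (cases x)
      (simp_all add: word_val_append[of g1, OF g1c] word_val_gen[of g1, OF g1c] g1 pow_y
        commutators_y comm_y cd pows commutator_mult_right m_assoc)
  obtain f1 where f1: "f1 \<in> hom G G" "f1 z = z" "\<And>x. f1 (g x) = g1 x"
  proof (rule hom_extension[of g1 k])
    show "commutator G (g1 GA) (g1 GD) = commutator G (g GA) (g GD)"
      by (simp add: g1 commutators_y) (simp add: abcd)
  qed (use g1c rel1 k in \<open>simp_all add: abcd\<close>)
  interpret f1: group_hom G G f1 using f1 by (simp add: group_hom_def group_hom_axioms_def)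
  have f1_simps: "f1 a = a \<otimes> y" "f1 b = b \<otimes> y" "f1 c = c \<otimes> d" "f1 d = d" "f1 y = y"
    by (simp_all add: abcd f1 y_def f1.hom_nat_pow) (simp_all add: g1 abcd y_def)

  let ?h = "commutator G a b"
  have hp: "?h [^] p = \<one>" by (simp add: abcd commutator_g_pow)
  have hc: "?h \<otimes> x = x \<otimes> ?h" if "x \<in> carrier G" for x
    using that by (intro commutator_central) simp_all
  \<comment> \<open>Only \<open>d\<close> changes, by a central factor with trivial
    \<open>p\<close>-th power, so all powers and commutators in the relations stay the same.\<close>
  define g2 where "g2 = (\<lambda>x. case x of GA \<Rightarrow> a | GB \<Rightarrow> b | GC \<Rightarrow> c | GD \<Rightarrow> d \<otimes> ?h)"
  have g2: "g2 GA = a" "g2 GB = b" "g2 GC = c" "g2 GD = d \<otimes> ?h"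
    by (simp_all add: g2_def)
  have g2c: "g2 x \<in> carrier G" for x by (cases x) (simp_all add: g2)
  have comm_h: "commutator G u ?h = \<one>" if "u \<in> carrier G" for u
    using that hc[of u] by (simp add: commutator_eq_one_iff)
  have pow_h: "(d \<otimes> ?h) [^] p = d [^] p"
    using hc[of d] by (simp add: pow_mult_distrib hp)
  have rel2: "g2 x [^] p = commutator G (word_val G g2 (fst (power_relation x)))
        (word_val G g2 (snd (power_relation x)))" for x
    by (cases x)
      (simp_all add: word_val_append[of g2, OF g2c] word_val_gen[of g2, OF g2c] g2 pow_h
        comm_h pows commutator_mult_right m_assoc)
  obtain f2 where f2: "f2 \<in> hom G G" "f2 z = z" "\<And>x. f2 (g x) = g2 x"
  proof (rule hom_extension[of g2 k])
    show "commutator G (g2 GA) (g2 GD) = commutator G (g GA) (g GD)"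
      by (simp add: g2 comm_h commutator_mult_right) (simp add: abcd)
  qed (use g2c rel2 k in \<open>simp_all add: abcd\<close>)
  interpret f2: group_hom G G f2 using f2 by (simp add: group_hom_def group_hom_axioms_def)
  have f2_simps: "f2 a = a" "f2 b = b" "f2 c = c" "f2 d = d \<otimes> ?h"
    by (simp_all add: abcd f2) (simp_all add: g2 abcd)

  have "a = f1 (a \<otimes> inv y)" "b = f1 (b \<otimes> inv y)" "c = f1 (c \<otimes> inv d)" "d = f1 d"
    by (simp_all add: f1_simps m_assoc)
  then have "g x \<in> f1 ` carrier G" for x
    unfolding abcd by (cases x)
      (metis abcd abcd_closed imageI inv_closed m_closed y)+
  moreover have "z \<in> f1 ` carrier G" using f1(2) by (metis imageI z_closed)
  ultimately have auto1: "restrict f1 (carrier G) \<in> auto G" using f1(1) by (intro restrict_auto)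
  have "f2 ?h = ?h" by (simp add: commutator_def f2_simps)
  then have "a = f2 a" "b = f2 b" "c = f2 c" "d = f2 (d \<otimes> inv ?h)"
    by (simp_all add: f2_simps m_assoc)
  then have "g x \<in> f2 ` carrier G" for x
    unfolding abcd by (cases x)
      (metis abcd abcd_closed imageI inv_closed m_closed commutator_closed)+
  moreover have "z \<in> f2 ` carrier G" using f2(2) by (metis imageI z_closed)
  ultimately have auto2: "restrict f2 (carrier G) \<in> auto G" using f2(1) by (intro restrict_auto)

  let ?f1 = "restrict f1 (carrier G)" and ?f2 = "restrict f2 (carrier G)"
  interpret A: comm_group "AutoGroup G" using miller by (simp add: miller_group_def)
  have "?f1 \<otimes>\<^bsub>AutoGroup G\<^esub> ?f2 = ?f2 \<otimes>\<^bsub>AutoGroup G\<^esub> ?f1"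
    using auto1 auto2 by (intro A.m_comm) (simp_all add: AutoGroup_def)
  then have "compose (carrier G) ?f1 ?f2 = compose (carrier G) ?f2 ?f1"
    using auto1 auto2 by (simp add: AutoGroup_def BijGroup_def auto_def)
  \<comment> \<open>At \<open>c\<close> the composites give \<open>c d\<close> and
    \<open>c d [a, b]\<close>.\<close>
  then have "compose (carrier G) ?f1 ?f2 c = compose (carrier G) ?f2 ?f1 c" by simp
  then have "c \<otimes> d = c \<otimes> (d \<otimes> ?h)"
    by (simp add: compose_def f1_simps f2_simps)
  then have "?h = \<one>" by simp
  then show False using commutator_GA_GB_ne_one by (simp add: abcd)
qed

end

section \<open>Specialization of the amalgam to the two choices of \<open>M\<close>\<close>

theorem theoremA:
  fixes p :: nat
    and G\<^sub>1 :: "('g, 'm) monoid_scheme"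
    and H M :: "'g set"
    and a b c d z :: 'g
  assumes "Factorial_Ring.prime p" and "odd p"
    and "group G\<^sub>1" and "subgroup H G\<^sub>1"
    and "has_presentation (G\<^sub>1\<lparr>carrier := H\<rparr>)
           (\<lambda>x. case x of GA \<Rightarrow> a | GB \<Rightarrow> b | GC \<Rightarrow> c | GD \<Rightarrow> d) (H_relations p)"
    and "z \<in> carrier G\<^sub>1" and "group.ord G\<^sub>1 z = p ^ 2"
    and "subgroup M G\<^sub>1" and "M \<subseteq> derived G\<^sub>1 H" and "card M = p"
    and "\<not> M \<subseteq> power_subgroup G\<^sub>1 H p"
    and "amalgamated_semidirect G\<^sub>1 H (generate G\<^sub>1 {z}) M"
    and "\<forall>h \<in> H. z \<otimes>\<^bsub>G\<^sub>1\<^esub> h = h \<otimes>\<^bsub>G\<^sub>1\<^esub> z"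
  shows "finite_p_group p G\<^sub>1 \<and> \<not> special_p_group p G\<^sub>1
       \<and> (M = generate G\<^sub>1 {commutator G\<^sub>1 a b} \<longrightarrow> miller_group G\<^sub>1)
       \<and> (M = generate G\<^sub>1 {commutator G\<^sub>1 a d} \<longrightarrow> \<not> miller_group G\<^sub>1)"
proof -
  let ?g = "\<lambda>x. case x of GA \<Rightarrow> a | GB \<Rightarrow> b | GC \<Rightarrow> c | GD \<Rightarrow> d"
  have int: "H \<inter> generate G\<^sub>1 {z} = M"
    using assms(12) by (simp add: amalgamated_semidirect_def)
  have "H_amalgam G\<^sub>1 p H ?g z"
    using assms int
    by (simp add: H_amalgam_def H_amalgam_axioms_def amalgamated_semidirect_def)
  then interpret H_amalgam G\<^sub>1 p H ?g z .
  have "miller_group G\<^sub>1" if M: "M = generate G\<^sub>1 {commutator G\<^sub>1 a b}"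
  proof -
    let ?e = "commutator G\<^sub>1 a b"
    have e [simp]: "?e \<in> carrier G\<^sub>1" using g_closed[of GA] g_closed[of GB] by simp
    have "?e [^]\<^bsub>G\<^sub>1\<^esub> p = \<one>\<^bsub>G\<^sub>1\<^esub>"
      using commutator_g_pow[of b GA] g_closed[of GB] by simp
    then have "ord ?e \<noteq> 0" using pow_eq_id[of ?e p] p_gt_1 by (intro notI) simp
    then have "generate G\<^sub>1 {?e} = {?e [^]\<^bsub>G\<^sub>1\<^esub> k |k. k \<in> (UNIV :: nat set)}"
      by (intro generate_pow_nat) simp_all
    \<comment> \<open>As \<open>z^p\<close> lies in \<open>M\<close>, it is a power of
      \<open>[a, b]\<close>; the exponent is the parameter of \<open>H_amalgam_ab\<close>.\<close>
    then obtain k :: nat where "z [^]\<^bsub>G\<^sub>1\<^esub> p = ?e [^]\<^bsub>G\<^sub>1\<^esub> k"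
      using z_pow_p_mem unfolding int M by auto
    then interpret H_amalgam_ab G\<^sub>1 p H ?g z k
      by unfold_locales simp
    show ?thesis by (rule miller_group_G)
  qed
  moreover have "\<not> miller_group G\<^sub>1" if "M = generate G\<^sub>1 {commutator G\<^sub>1 a d}"
    using not_miller_group_G int that by simp
  ultimately show ?thesis using finite_p_group_G not_special by blast
qed

end
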